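(* A countable discrete group $G$ is amenable at infinity if and only if it admits an amenable action on the Hilbert cube $I^{\aleph_0}=[0,1]^{\mathbb N}$.
   Context: For a countable discrete group $G$, $\mathbb P(G)=\{b\colon G\to[0,1] : \sum_{g}b(g)=1\}\subset\ell^1(G)$ carries the weak* (pointwise) topology, and $G$ acts on it by $(gb)(h)=b(g^{-1}h)$. An action of $G$ by homeomorphisms on a compact Hausdorff space $X$ is amenable if there is a sequence of continuous maps $b^n\colon X\to\mathbb P(G)$ such that for every $g\in G$, $\lim_{n\to\infty}\sup_{x\in X}\|g b^n_x-b^n_{gx}\|_1=0$. $G$ is amenable at infinity if it admits an amenable action on some compact Hausdorff space. *)

theory Defs
  imports "HOL-Analysis.Analysis" "HOL-Algebra.Group"
begin

definition prob_vec :: "('g, 'b) monoid_scheme \<Rightarrow> ('g \<Rightarrow> real) \<Rightarrow> bool" where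
  "prob_vec G b \<longleftrightarrow> (\<forall>h\<in>carrier G. 0 \<le> b h) \<and> (b has_sum 1) (carrier G)"

definition translate :: "('g, 'b) monoid_scheme \<Rightarrow> 'g \<Rightarrow> ('g \<Rightarrow> real) \<Rightarrow> ('g \<Rightarrow> real)" where
  "translate G g b = (\<lambda>h. b (inv\<^bsub>G\<^esub> g \<otimes>\<^bsub>G\<^esub> h))"

definition l1dist :: "('g, 'b) monoid_scheme \<Rightarrow> ('g \<Rightarrow> real) \<Rightarrow> ('g \<Rightarrow> real) \<Rightarrow> real" where
  "l1dist G b c = infsum (\<lambda>h. \<bar>b h - c h\<bar>) (carrier G)"

definition top_action :: "('g, 'b) monoid_scheme \<Rightarrow> 'x topology \<Rightarrow> ('g \<Rightarrow> 'x \<Rightarrow> 'x) \<Rightarrow> bool" where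
  "top_action G X \<alpha> \<longleftrightarrow>
     (\<forall>g\<in>carrier G. homeomorphic_map X X (\<alpha> g)) \<and>
     (\<forall>x\<in>topspace X. \<alpha> \<one>\<^bsub>G\<^esub> x = x) \<and>
     (\<forall>g\<in>carrier G. \<forall>h\<in>carrier G. \<forall>x\<in>topspace X. \<alpha> (g \<otimes>\<^bsub>G\<^esub> h) x = \<alpha> g (\<alpha> h x))"

text \<open>Amenable action: a sequence of maps b^n : X \<rightarrow> P(G), continuous for the
  pointwise (weak-star) topology on P(G), with
  sup_x || g b^n_x - b^n_{gx} ||_1 \<rightarrow> 0 for every g (limit of the sup written out).\<close>
definition amenable_action :: "('g, 'b) monoid_scheme \<Rightarrow> 'x topology \<Rightarrow> ('g \<Rightarrow> 'x \<Rightarrow> 'x) \<Rightarrow> bool" where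
  "amenable_action G X \<alpha> \<longleftrightarrow> top_action G X \<alpha> \<and>
     (\<exists>bn :: nat \<Rightarrow> 'x \<Rightarrow> 'g \<Rightarrow> real.
        (\<forall>n. \<forall>x\<in>topspace X. prob_vec G (bn n x)) \<and>
        (\<forall>n. \<forall>h\<in>carrier G. continuous_map X euclideanreal (\<lambda>x. bn n x h)) \<and>
        (\<forall>g\<in>carrier G. \<forall>\<epsilon>>0. \<exists>N. \<forall>n\<ge>N. \<forall>x\<in>topspace X.
            l1dist G (translate G g (bn n x)) (bn n (\<alpha> g x)) \<le> \<epsilon>))"

definition amenable_at_infinity_on :: "'x itself \<Rightarrow> ('g, 'b) monoid_scheme \<Rightarrow> bool" where
  "amenable_at_infinity_on _ G \<longleftrightarrow>
     (\<exists>(X :: 'x topology) \<alpha>. topspace X \<noteq> {} \<and> compact_space X \<and> Hausdorff_space X \<and>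
        amenable_action G X \<alpha>)"

definition hilbert_cube :: "(nat \<Rightarrow> real) topology" where
  "hilbert_cube = subtopology (product_topology (\<lambda>_. euclideanreal) UNIV) {f. \<forall>n. f n \<in> {0..1}}"

end

(*
Fix an amenable action on X and a point x0. The families k(n, g) = 2 b^n at g^-1 x0, truncated to a
finite set, satisfy shift-invariant convex constraints (mass at least 1, bounded norm, small variation in
g), and the set K of all families satisfying slightly relaxed constraints is a compact convex G-space on
which normalisation of |k(n, 1)| witnesses amenability. Because of the relaxation, K contains a segment
around k in every coordinate direction, and such a compact convex subset of R^N is homeomorphic to the
Hilbert cube (Keller's theorem). For this, write K as the inverse limit of its projections C_n to R^n:
C_(n+1) is homeomorphic to C_n x [-1,1] by a map moving the first n coordinates arbitrarily little, so
the cube is carried onto C_n x [-1,1]^N for every n by homeomorphisms which, if each step is chosen small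
relative to the moduli of the previous ones, converge to a homeomorphism from the cube onto K.
*)
theory Submission
  imports Defs
begin

section \<open>Minkowski functionals\<close>

text \<open>The kernels are truncated because a pointwise limit of probability vectors can lose
  mass: with one finite support per level n, having mass at least 1 is a closed condition and
  normalisation is continuous. The factor 2 pays for the truncation and for perturbations: mass 3/2
  remains, and changing one entry by at most 1/2 leaves at least 1. Perturbed entries may be
  negative, hence the absolute values. The relaxation at level n is positive, which makes room, and
  tends to 0, which saves amenability.

  In Keller's theorem the obstacle is a boundary effect. Over a boundary point of C_n the fibre of
  C_(n+1) may shrink to a point, so stretching fibres does not give C_n x [-1,1]; a radial map
  between the two bodies is a homeomorphism but may move the first n coordinates far. Fibres are
  therefore altered only between two auxiliary bodies, each radially close to one of the given
  ones.\<close>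

lemma continuous_on_coordinate: "continuous_on S (\<lambda>z :: nat \<Rightarrow> real. z i)"
  by (rule continuous_on_subset[of UNIV]) auto

lemma tendsto_coordinate: "((\<lambda>z. z i) \<longlongrightarrow> w i) (at (w :: nat \<Rightarrow> real) within S)"
  using continuous_on_coordinate[of UNIV i] by (simp add: continuous_on_def tendsto_within_subset[of _ _ _ UNIV])

text \<open>The infimum is the junk value \<open>Inf {}\<close> when \<open>C\<close> does not absorb \<open>z\<close>.\<close>

definition minkowski :: "(nat \<Rightarrow> real) set \<Rightarrow> (nat \<Rightarrow> real) \<Rightarrow> real" where
  "minkowski C z = Inf {s. 0 < s \<and> (\<lambda>i. z i / s) \<in> C}"

text \<open>The half-cylinders \<open>below n\<close> and \<open>above n\<close> to which this
  applies are not symmetric, so gauges scale by positive factors only. They may also vanish at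
  nonzero vectors. Absorption at every point keeps them finite.\<close>

locale convex_absorbing =
  fixes C :: "(nat \<Rightarrow> real) set"
  assumes conv: "\<And>x y u. x \<in> C \<Longrightarrow> y \<in> C \<Longrightarrow> 0 \<le> u \<Longrightarrow> u \<le> 1 \<Longrightarrow> (\<lambda>i. (1 - u) * x i + u * y i) \<in> C"
    and absorb: "\<And>z. \<exists>s>0. (\<lambda>i. z i / s) \<in> C"
begin

lemma zero: "(\<lambda>i. 0) \<in> C"
  using absorb[of "\<lambda>i. 0"] by auto

lemma scale_up: assumes "0 < s" "(\<lambda>i. z i / s) \<in> C" "s \<le> t" shows "(\<lambda>i. z i / t) \<in> C"
proof -
  have "(\<lambda>i. (1 - s / t) * 0 + (s / t) * (z i / s)) \<in> C"
    using assms by (intro conv[OF zero assms(2)]) auto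
  with assms show ?thesis by (simp add: field_simps)
qed

lemma bdd: "bdd_below {s. 0 < s \<and> (\<lambda>i. z i / s) \<in> C}"
  by (rule bdd_belowI[of _ 0]) auto

lemma minkowski_nonneg: "0 \<le> minkowski C z"
  unfolding minkowski_def using absorb[of z] by (intro cInf_greatest) auto

lemma minkowski_le: "0 < s \<Longrightarrow> (\<lambda>i. z i / s) \<in> C \<Longrightarrow> minkowski C z \<le> s"
  unfolding minkowski_def by (rule cInf_lower[OF _ bdd]) auto

lemma minkowski_less: assumes "minkowski C z < s" shows "0 < s" "(\<lambda>i. z i / s) \<in> C"
proof -
  obtain t where t: "0 < t" "(\<lambda>i. z i / t) \<in> C" "t < s"
    using assms absorb[of z] unfolding minkowski_def
    by (subst (asm) cInf_less_iff[OF _ bdd]) auto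
  show "0 < s" using t by simp
  show "(\<lambda>i. z i / s) \<in> C" using scale_up[OF t(1,2)] t(3) by simp
qed

lemma minkowski_leI: assumes "\<And>s. r < s \<Longrightarrow> 0 < s \<and> (\<lambda>i. z i / s) \<in> C" shows "minkowski C z \<le> r"
proof (rule dense_ge)
  fix s assume "r < s"
  then show "minkowski C z \<le> s" using assms[of s] minkowski_le[of s z] by simp
qed

lemma minkowski_triangle: "minkowski C (\<lambda>i. x i + y i) \<le> minkowski C x + minkowski C y"
proof (rule minkowski_leI)
  fix s assume s: "minkowski C x + minkowski C y < s"
  define d where "d = (s - minkowski C x - minkowski C y) / 2"
  have d: "d > 0" using s by (simp add: d_def)
  define a b where "a = minkowski C x + d" and "b = minkowski C y + d"
  have ab: "s = a + b" by (simp add: a_def b_def d_def)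
  have a: "0 < a" "(\<lambda>i. x i / a) \<in> C" using minkowski_less[of x a] d by (auto simp: a_def)
  have b: "0 < b" "(\<lambda>i. y i / b) \<in> C" using minkowski_less[of y b] d by (auto simp: b_def)
  have "(\<lambda>i. (1 - b / s) * (x i / a) + (b / s) * (y i / b)) \<in> C"
    using a b ab by (intro conv) auto
  moreover have "(1 - b / s) * (x i / a) + (b / s) * (y i / b) = (x i + y i) / s" for i
  proof -
    have "1 - b / s = a / s" using a b ab by (simp add: field_simps)
    then show ?thesis using a b ab by (simp add: add_divide_distrib)
  qed
  ultimately show "0 < s \<and> (\<lambda>i. (x i + y i) / s) \<in> C" using a b ab by simp
qed

lemma minkowski_scale_le: assumes "0 < c" shows "minkowski C (\<lambda>i. c * z i) \<le> c * minkowski C z"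
proof (rule minkowski_leI)
  fix s assume "c * minkowski C z < s"
  then have *: "minkowski C z < s / c" using assms by (simp add: field_simps)
  show "0 < s \<and> (\<lambda>i. c * z i / s) \<in> C"
    using minkowski_less[OF *] assms by (simp add: field_simps zero_less_divide_iff)
qed

lemma minkowski_scale: assumes "0 < c" shows "minkowski C (\<lambda>i. c * z i) = c * minkowski C z"
proof (rule antisym[OF minkowski_scale_le[OF assms]])
  have "minkowski C (\<lambda>i. inverse c * (c * z i)) \<le> inverse c * minkowski C (\<lambda>i. c * z i)"
    using assms by (intro minkowski_scale_le) auto
  then show "c * minkowski C z \<le> minkowski C (\<lambda>i. c * z i)"
    using assms by (simp add: field_simps)
qed

lemma minkowski_zero: "minkowski C (\<lambda>i. 0) = 0"
  using minkowski_leI[of 0 "\<lambda>i. 0"] minkowski_nonneg[of "\<lambda>i. 0"] zero by simp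

text \<open>A gauge may differ on opposite vectors, so the bound adds its values at both unit
  vectors of the axis.\<close>

lemma minkowski_axis: "minkowski C (\<lambda>i. if i = k then r else 0) \<le>
   \<bar>r\<bar> * (minkowski C (\<lambda>i. if i = k then 1 else 0) + minkowski C (\<lambda>i. if i = k then -1 else 0))"
proof -
  consider "r = 0" | "r > 0" | "r < 0" by linarith
  then show ?thesis
  proof cases
    case 1
    then have "(\<lambda>i. if i = k then r else 0) = (\<lambda>i. 0)" by auto
    with 1 show ?thesis by (simp only: minkowski_zero)
  next
    case 2
    have "(\<lambda>i. if i = k then r else 0) = (\<lambda>i. r * (if i = k then 1 else 0))" by auto
    then show ?thesis using 2 minkowski_scale[of r] minkowski_nonneg by (simp add: distrib_left)
  next
    case 3
    have "(\<lambda>i. if i = k then r else 0) = (\<lambda>i. (-r) * (if i = k then -1 else 0))" by auto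
    then have "minkowski C (\<lambda>i. if i = k then r else 0) = (-r) * minkowski C (\<lambda>i. if i = k then -1 else 0)"
      using 3 minkowski_scale[of "-r"] by (metis neg_0_less_iff_less)
    then show ?thesis using 3 minkowski_nonneg mult_nonpos_nonneg[of r] by (simp add: distrib_left)
  qed
qed

text \<open>Subadditivity splits a truncated vector into finitely many axis components. The
  resulting linear bound is the source of the Lipschitz estimate for gauges of cylinders.\<close>

lemma minkowski_truncate: "\<exists>B\<ge>0. \<forall>z. minkowski C (\<lambda>i. if i < N then z i else 0) \<le> B * (\<Sum>i<N. \<bar>z i\<bar>)"
proof (induction N)
  case 0 then show ?case by (auto simp: minkowski_zero intro: exI[of _ 0])
next
  case (Suc N)
  then obtain B where B: "B \<ge> 0" "\<And>z. minkowski C (\<lambda>i. if i < N then z i else 0) \<le> B * (\<Sum>i<N. \<bar>z i\<bar>)"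
    by blast
  define b where "b = minkowski C (\<lambda>i. if i = N then 1 else 0) + minkowski C (\<lambda>i. if i = N then -1 else 0)"
  have b: "b \<ge> 0" using minkowski_nonneg by (simp add: b_def)
  have "minkowski C (\<lambda>i. if i < Suc N then z i else 0) \<le> (B + b) * (\<Sum>i<Suc N. \<bar>z i\<bar>)" for z
  proof -
    have "minkowski C (\<lambda>i. if i < Suc N then z i else 0) =
       minkowski C (\<lambda>i. (if i < N then z i else 0) + (if i = N then z N else 0))"
      by (intro arg_cong[of _ _ "minkowski C"]) auto
    also have "\<dots> \<le> B * (\<Sum>i<N. \<bar>z i\<bar>) + \<bar>z N\<bar> * b"
      using minkowski_triangle[of "\<lambda>i. if i < N then z i else 0" "\<lambda>i. if i = N then z N else 0"]
        B(2)[of z] minkowski_axis[of N "z N"] unfolding b_def by linarith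
    also have "\<dots> \<le> (B + b) * (\<Sum>i<Suc N. \<bar>z i\<bar>)"
      using B(1) b by (simp add: algebra_simps sum_nonneg)
    finally show ?thesis .
  qed
  then show ?case using B(1) b by (intro exI[of _ "B + b"]) auto
qed

lemma minkowski_cong:
  assumes "\<And>x y. x \<in> C \<Longrightarrow> (\<And>i. i < N \<Longrightarrow> x i = y i) \<Longrightarrow> y \<in> C" and "\<And>i. i < N \<Longrightarrow> z i = w i"
  shows "minkowski C z = minkowski C w"
proof -
  have "(\<lambda>i. z i / s) \<in> C \<longleftrightarrow> (\<lambda>i. w i / s) \<in> C" for s
    using assms by (metis (no_types, lifting))
  then show ?thesis by (simp add: minkowski_def)
qed

text \<open>The hypothesis makes \<open>C\<close> a cylinder over its first \<open>N\<close>
  coordinates. Tails can thus be cut off, and subadditivity gives a Lipschitz bound in finitely many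
  coordinates, which implies continuity in the product topology.\<close>

lemma continuous_minkowski:
  assumes "\<And>x y. x \<in> C \<Longrightarrow> (\<And>i. i < N \<Longrightarrow> x i = y i) \<Longrightarrow> y \<in> C"
  shows "continuous_on UNIV (minkowski C)"
proof -
  obtain B where B: "B \<ge> 0" "\<And>z. minkowski C (\<lambda>i. if i < N then z i else 0) \<le> B * (\<Sum>i<N. \<bar>z i\<bar>)"
    using minkowski_truncate[of N] by blast
  have B': "minkowski C z \<le> B * (\<Sum>i<N. \<bar>z i\<bar>)" for z
    using B(2)[of z] minkowski_cong[of N z "\<lambda>i. if i < N then z i else 0", OF assms] by simp
  have one: "minkowski C z \<le> minkowski C w + B * (\<Sum>i<N. \<bar>z i - w i\<bar>)" for z w
    using minkowski_triangle[of w "\<lambda>i. z i - w i"] B'[of "\<lambda>i. z i - w i"] by simp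
  have lip: "\<bar>minkowski C z - minkowski C w\<bar> \<le> B * (\<Sum>i<N. \<bar>z i - w i\<bar>)" for z w
    using one[of z w] one[of w z] by (simp add: abs_minus_commute)
  have "(minkowski C \<longlongrightarrow> minkowski C w) (at w)" for w
  proof (rule LIM_zero_cancel, rule Lim_null_comparison)
    show "\<forall>\<^sub>F z in at w. norm (minkowski C z - minkowski C w) \<le> B * (\<Sum>i<N. \<bar>z i - w i\<bar>)"
      using lip by simp
    have c: "((\<lambda>z. z i) \<longlongrightarrow> w i) (at w)" for i
      by (rule tendsto_coordinate)
    have "((\<lambda>z. B * (\<Sum>i<N. \<bar>z i - w i\<bar>)) \<longlongrightarrow> B * (\<Sum>i<N. \<bar>w i - w i\<bar>)) (at w)"
      by (intro tendsto_intros c)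
    then show "((\<lambda>z. B * (\<Sum>i<N. \<bar>z i - w i\<bar>)) \<longlongrightarrow> 0) (at w)" by simp
  qed
  then show ?thesis by (simp add: continuous_on)
qed

end

lemma minkowski_mono:
  assumes "convex_absorbing C" "convex_absorbing D" "C \<subseteq> D" shows "minkowski D z \<le> minkowski C z"
  using assms convex_absorbing.minkowski_leI[of D "minkowski C z" z] convex_absorbing.minkowski_less[of C z] by blast

lemma minkowski_Int:
  assumes "convex_absorbing C" "convex_absorbing D" "convex_absorbing (C \<inter> D)"
  shows "minkowski (C \<inter> D) z = max (minkowski C z) (minkowski D z)"
proof (rule antisym)
  show "minkowski (C \<inter> D) z \<le> max (minkowski C z) (minkowski D z)"
    using convex_absorbing.minkowski_less[OF assms(1), of z] convex_absorbing.minkowski_less[OF assms(2), of z]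
    by (intro convex_absorbing.minkowski_leI[OF assms(3)]) auto
  show "max (minkowski C z) (minkowski D z) \<le> minkowski (C \<inter> D) z"
    using minkowski_mono[OF assms(3,1)] minkowski_mono[OF assms(3,2)] by simp
qed

text \<open>A scale s strictly between the two sides would put z/s into \<open>C\<close> or
  \<open>D\<close> and so bound one of their gauges by s. Convexity of the union guarantees that
  every scale above its gauge is admissible.\<close>

lemma minkowski_Un:
  assumes "convex_absorbing C" "convex_absorbing D" "convex_absorbing (C \<union> D)"
  shows "minkowski (C \<union> D) z = min (minkowski C z) (minkowski D z)"
proof (rule antisym)
  show "minkowski (C \<union> D) z \<le> min (minkowski C z) (minkowski D z)"
    using minkowski_mono[OF assms(1,3)] minkowski_mono[OF assms(2,3)] by simp
  show "min (minkowski C z) (minkowski D z) \<le> minkowski (C \<union> D) z"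
  proof (rule ccontr)
    assume "\<not> ?thesis"
    then obtain s where s: "minkowski (C \<union> D) z < s" "s < min (minkowski C z) (minkowski D z)"
      using dense by (meson not_le)
    from convex_absorbing.minkowski_less[OF assms(3) s(1)]
    show False using s(2) convex_absorbing.minkowski_le[OF assms(1), of s z]
       convex_absorbing.minkowski_le[OF assms(2), of s z] by auto
  qed
qed

section \<open>Radial maps that rescale finitely many coordinates\<close>

definition scale_first :: "nat \<Rightarrow> real \<Rightarrow> (nat \<Rightarrow> real) \<Rightarrow> (nat \<Rightarrow> real)" where
  "scale_first N c z = (\<lambda>i. if i < N then c * z i else z i)"

text \<open>The quotient need not have a limit where \<open>q2\<close> vanishes; near such points it
  is bounded by |A| while the coordinates it multiplies tend to 0. Division by zero gives the factor
  0 there, which is harmless because those coordinates are already 0.\<close>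

lemma radial_continuous:
  assumes c: "continuous_on UNIV q1" "continuous_on UNIV q2"
    and n: "\<And>z. 0 \<le> q1 z" "\<And>z. 0 \<le> q2 z"
    and le: "\<And>z. q1 z \<le> A * q2 z"
    and zero: "\<And>z i. q2 z = 0 \<Longrightarrow> i < N \<Longrightarrow> z i = 0"
  shows "continuous_on UNIV (\<lambda>z. scale_first N (q1 z / q2 z) z)"
proof (rule continuous_on_coordinatewise_then_product)
  fix i
  have "((\<lambda>z. scale_first N (q1 z / q2 z) z i) \<longlongrightarrow> scale_first N (q1 w / q2 w) w i) (at w)" for w
  proof -
    have ci: "((\<lambda>z. z i) \<longlongrightarrow> w i) (at w)"
      by (rule tendsto_coordinate)
    have c': "(q1 \<longlongrightarrow> q1 w) (at w)" "(q2 \<longlongrightarrow> q2 w) (at w)" using c by (auto simp: continuous_on)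
    show ?thesis
    proof (cases "i < N \<and> q2 w = 0")
      case False
      then show ?thesis using ci c' by (cases "i < N") (auto simp: scale_first_def intro!: tendsto_intros)
    next
      case True
      have *: "\<bar>q1 z / q2 z * z i\<bar> \<le> \<bar>A\<bar> * \<bar>z i\<bar>" for z
      proof -
        have "q1 z / q2 z \<le> \<bar>A\<bar>"
        proof (cases "q2 z = 0")
          case False
          then have "q2 z > 0" using n(2)[of z] by simp
          moreover have "A * q2 z \<le> \<bar>A\<bar> * q2 z" using n(2)[of z] by (intro mult_right_mono) auto
          with le[of z] have "q1 z \<le> \<bar>A\<bar> * q2 z" by linarith
          ultimately show ?thesis by (simp only: pos_divide_le_eq)
        qed auto
        from mult_right_mono[OF this, of "\<bar>z i\<bar>"] show ?thesis using n[of z] by (simp add: abs_mult)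
      qed
      have "((\<lambda>z. \<bar>A\<bar> * \<bar>z i\<bar>) \<longlongrightarrow> \<bar>A\<bar> * \<bar>w i\<bar>) (at w)" by (intro tendsto_intros ci)
      moreover have "w i = 0" using True zero by blast
      ultimately have lim: "((\<lambda>z. \<bar>A\<bar> * \<bar>z i\<bar>) \<longlongrightarrow> 0) (at w)" by simp
      have "((\<lambda>z. q1 z / q2 z * z i) \<longlongrightarrow> 0) (at w)"
        by (rule Lim_null_comparison[OF _ lim]) (use * in simp)
      then show ?thesis using True by (simp add: scale_first_def)
    qed
  qed
  then show "continuous_on UNIV (\<lambda>z. scale_first N (q1 z / q2 z) z i)" by (simp add: continuous_on)
qed

lemma radial_value:
  assumes hom: "\<And>c z. 0 < c \<Longrightarrow> q2 (scale_first N c z) = c * q2 z"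
    and n: "0 \<le> q1 z" "0 \<le> q2 z"
    and zero: "q1 z = 0 \<longleftrightarrow> q2 z = 0" and zero': "\<And>i. q2 z = 0 \<Longrightarrow> i < N \<Longrightarrow> z i = 0"
  shows "q2 (scale_first N (q1 z / q2 z) z) = q1 z"
proof (cases "q2 z = 0")
  case True
  then have "scale_first N (q1 z / q2 z) z = z" using zero' by (auto simp: scale_first_def)
  then show ?thesis using True zero by simp
next
  case False
  then show ?thesis using n zero hom[of "q1 z / q2 z" z] by simp
qed

lemma radial_inverse:
  assumes hom1: "\<And>c z. 0 < c \<Longrightarrow> q1 (scale_first N c z) = c * q1 z"
    and hom2: "\<And>c z. 0 < c \<Longrightarrow> q2 (scale_first N c z) = c * q2 z"
    and n: "0 \<le> q1 z" "0 \<le> q2 z"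
    and zero: "q1 z = 0 \<longleftrightarrow> q2 z = 0" and zero': "\<And>i. q2 z = 0 \<Longrightarrow> i < N \<Longrightarrow> z i = 0"
    and w: "w = scale_first N (q1 z / q2 z) z"
  shows "scale_first N (q2 w / q1 w) w = z"
proof (cases "q2 z = 0")
  case True
  then have "w = z" using zero' unfolding w by (auto simp: scale_first_def)
  then show ?thesis using True zero zero' by (auto simp: scale_first_def)
next
  case False
  then have r: "q1 z / q2 z > 0" using n zero by (simp add: less_le)
  have "q2 w / q1 w = q2 z / q1 z" unfolding w using r False zero by (simp add: hom1[OF r] hom2[OF r])
  then show ?thesis using False zero unfolding w by (auto simp: scale_first_def)
qed

text \<open>On each ray in the first \<open>N\<close> coordinates the map turns the value of
  \<open>q1\<close> into the same value of \<open>q2\<close>, so unit balls correspond, and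
  exchanging the gauges gives the inverse. \<open>R\<close> carries conditions untouched by the
  rescaling.\<close>

lemma radial_bij:
  assumes hom: "\<And>c z. 0 < c \<Longrightarrow> q1 (scale_first N c z) = c * q1 z"
      "\<And>c z. 0 < c \<Longrightarrow> q2 (scale_first N c z) = c * q2 z"
    and n: "\<And>z. 0 \<le> q1 z" "\<And>z. 0 \<le> q2 z"
    and zero: "\<And>z. q1 z = 0 \<longleftrightarrow> q2 z = 0" and zero': "\<And>z i. q2 z = 0 \<Longrightarrow> i < N \<Longrightarrow> z i = 0"
    and R: "\<And>c z. R (scale_first N c z) = R z"
  shows "bij_betw (\<lambda>z. scale_first N (q1 z / q2 z) z) {z. q1 z \<le> 1 \<and> R z} {z. q2 z \<le> 1 \<and> R z}"
proof -
  have inv1: "scale_first N (q2 (scale_first N (q1 z / q2 z) z) / q1 (scale_first N (q1 z / q2 z) z))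
      (scale_first N (q1 z / q2 z) z) = z" for z
    by (rule radial_inverse[where ?q1.0 = q1 and ?q2.0 = q2]) (use assms in auto)
  have inv2: "scale_first N (q1 (scale_first N (q2 z / q1 z) z) / q2 (scale_first N (q2 z / q1 z) z))
      (scale_first N (q2 z / q1 z) z) = z" for z
    by (rule radial_inverse[where ?q1.0 = q2 and ?q2.0 = q1]) (use assms in auto)
  have val1: "q2 (scale_first N (q1 z / q2 z) z) = q1 z" for z
    by (rule radial_value) (use assms in auto)
  have val2: "q1 (scale_first N (q2 z / q1 z) z) = q2 z" for z
    by (rule radial_value) (use assms in auto)
  show ?thesis
    by (rule bij_betw_byWitness[where f' = "\<lambda>z. scale_first N (q2 z / q1 z) z"])
       (auto simp: inv1[unfolded val1] inv2[unfolded val2] val1 val2 R)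
qed

section \<open>Keller bodies\<close>

text \<open>Closedness and coordinatewise boundedness amount to compactness in the product topology.
  The segments in \<open>spikes\<close> may shrink as k grows: they put 0 in the interior of every
  finite projection, while \<open>K\<close> itself has empty interior.\<close>

locale keller_body =
  fixes K :: "(nat \<Rightarrow> real) set"
  assumes closed: "closed K"
    and convex: "\<And>x y u. x \<in> K \<Longrightarrow> y \<in> K \<Longrightarrow> 0 \<le> u \<Longrightarrow> u \<le> 1 \<Longrightarrow> (\<lambda>i. (1 - u) * x i + u * y i) \<in> K"
    and bounded: "\<And>i. \<exists>M. \<forall>x\<in>K. \<bar>x i\<bar> \<le> M"
    and spikes: "\<And>k. \<exists>e>0. (\<lambda>i. if i = k then e else 0) \<in> K \<and> (\<lambda>i. if i = k then - e else 0) \<in> K"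
begin

definition cyl :: "nat \<Rightarrow> (nat \<Rightarrow> real) set" where
  "cyl n = {x. \<exists>y\<in>K. \<forall>i<n. x i = y i}"

text \<open>Over the projection of \<open>K\<close> to n coordinates, the next projection lies
  between a lower and an upper boundary function. \<open>below n\<close> and \<open>above n\<close>
  each release one of these bounds, so that their union and intersection are consecutive
  cylinders.\<close>

definition below :: "nat \<Rightarrow> (nat \<Rightarrow> real) set" where
  "below n = {x. \<exists>y\<in>K. (\<forall>i<n. x i = y i) \<and> x n \<le> y n}"

definition above :: "nat \<Rightarrow> (nat \<Rightarrow> real) set" where
  "above n = {x. \<exists>y\<in>K. (\<forall>i<n. x i = y i) \<and> y n \<le> x n}"

definition prefix_gauge :: "nat \<Rightarrow> (nat \<Rightarrow> real) \<Rightarrow> real" where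
  "prefix_gauge n = minkowski (cyl n)"

text \<open>The projection of \<open>K\<close> to the first \<open>n\<close> coordinates times a cube in the remaining ones.\<close>

definition partial_cube :: "nat \<Rightarrow> (nat \<Rightarrow> real) set" where
  "partial_cube n = {z. prefix_gauge n z \<le> 1 \<and> (\<forall>i\<ge>n. \<bar>z i\<bar> \<le> 1)}"

lemma zero_mem: "(\<lambda>i. 0) \<in> K"
proof -
  obtain e where e: "(\<lambda>i. if i = 0 then e else 0) \<in> K" "(\<lambda>i. if i = 0 then - e else 0) \<in> K"
    using spikes by blast
  have "(\<lambda>i. (1 - 1/2) * (if i = 0 then e else 0) + 1/2 * (if i = (0::nat) then - e else 0)) \<in> K"
    by (rule convex[OF e]) auto
  moreover have "(\<lambda>i. (1 - 1/2) * (if i = 0 then e else 0) + 1/2 * (if i = (0::nat) then - e else 0)) = (\<lambda>i. 0)"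
    by auto
  ultimately show ?thesis by simp
qed

text \<open>The next coordinate is corrected by mixing in a point of a coordinate segment, which
  keeps the earlier ones proportional. The scale may grow without bound in n, so only the cylinders
  are absorbing, not \<open>K\<close>.\<close>

lemma prefix_absorb: "\<exists>s>0. \<exists>y\<in>K. \<forall>i<n. z i = s * y i"
proof (induction n)
  case 0 then show ?case using zero_mem by (auto intro!: exI[of _ 1])
next
  case (Suc n)
  then obtain s y where s: "s > 0" "y \<in> K" "\<And>i. i < n \<Longrightarrow> z i = s * y i" by blast
  obtain e where e: "e > 0" "(\<lambda>i. if i = n then e else 0) \<in> K" "(\<lambda>i. if i = n then - e else 0) \<in> K"
    using spikes by blast
  define r where "r = z n - s * y n"
  have comb: "\<exists>s>0. \<exists>y\<in>K. \<forall>i<Suc n. z i = s * y i"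
    if r: "r = t * d" and t: "t > 0" and d: "(\<lambda>i. if i = n then d else 0) \<in> K" for t d
  proof -
    define w where "w = (\<lambda>i. (1 - t / (s + t)) * y i + t / (s + t) * (if i = n then d else 0))"
    have "w \<in> K" unfolding w_def using s t d by (intro convex) auto
    moreover have "z i = (s + t) * w i" if "i < Suc n" for i
    proof -
      have "(s + t) * w i = ((s + t) * (1 - t / (s + t))) * y i + ((s + t) * (t / (s + t))) * (if i = n then d else 0)"
        unfolding w_def by (simp only: distrib_left mult.assoc)
      also have "(s + t) * (1 - t / (s + t)) = s" using s t by (simp add: field_simps)
      also have "(s + t) * (t / (s + t)) = t" using s t by simp
      finally show ?thesis using that s(3)[of i] r by (cases "i = n") (auto simp: r_def)
    qed
    ultimately show ?thesis using s t by (intro exI[of _ "s + t"]) auto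
  qed
  consider "r = 0" | "r > 0" | "r < 0" by linarith
  then show ?case
  proof cases
    case 1
    then show ?thesis using s by (auto simp: r_def less_Suc_eq)
  next
    case 2
    then show ?thesis using comb[of "r / e" e] e by simp
  next
    case 3
    then show ?thesis using comb[of "- r / e" "- e"] e by (simp add: divide_neg_pos)
  qed
qed

lemma cyl_prefix: "\<exists>s>0. (\<lambda>i. z i / s) \<in> cyl n"
proof -
  obtain s y where "s > 0" "y \<in> K" "\<forall>i<n. z i = s * y i" using prefix_absorb by blast
  then show ?thesis by (auto simp: cyl_def intro!: exI[of _ s] bexI[of _ y])
qed

lemma cyl_Suc_subset: "cyl (Suc n) \<subseteq> below n" "cyl (Suc n) \<subseteq> above n"
  by (auto simp: cyl_def below_def above_def)

lemma convex_absorbing_cyl: "convex_absorbing (cyl n)"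
proof
  show "\<exists>s>0. (\<lambda>i. z i / s) \<in> cyl n" for z by (rule cyl_prefix)
next
  fix x y and u :: real assume "x \<in> cyl n" "y \<in> cyl n" and u: "0 \<le> u" "u \<le> 1"
  then obtain x' y' where "x' \<in> K" "y' \<in> K" "\<forall>i<n. x i = x' i" "\<forall>i<n. y i = y' i"
    by (auto simp: cyl_def)
  then show "(\<lambda>i. (1 - u) * x i + u * y i) \<in> cyl n"
    using convex[of x' y' u] u by (auto simp: cyl_def)
qed

lemma convex_absorbing_below: "convex_absorbing (below n)"
proof
  show "\<exists>s>0. (\<lambda>i. z i / s) \<in> below n" for z using cyl_prefix cyl_Suc_subset by blast
next
  fix x y and u :: real assume "x \<in> below n" "y \<in> below n" and u: "0 \<le> u" "u \<le> 1"
  then obtain x' y' where "x' \<in> K" "y' \<in> K" "\<forall>i<n. x i = x' i" "\<forall>i<n. y i = y' i" "x n \<le> x' n" "y n \<le> y' n"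
    by (auto simp: below_def)
  then show "(\<lambda>i. (1 - u) * x i + u * y i) \<in> below n"
    using convex[of x' y' u] u
    by (auto simp: below_def intro!: bexI[of _ "\<lambda>i. (1 - u) * x' i + u * y' i"] add_mono mult_left_mono)
qed

lemma convex_absorbing_above: "convex_absorbing (above n)"
proof
  show "\<exists>s>0. (\<lambda>i. z i / s) \<in> above n" for z using cyl_prefix cyl_Suc_subset by blast
next
  fix x y and u :: real assume "x \<in> above n" "y \<in> above n" and u: "0 \<le> u" "u \<le> 1"
  then obtain x' y' where "x' \<in> K" "y' \<in> K" "\<forall>i<n. x i = x' i" "\<forall>i<n. y i = y' i" "x' n \<le> x n" "y' n \<le> y n"
    by (auto simp: above_def)
  then show "(\<lambda>i. (1 - u) * x i + u * y i) \<in> above n"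
    using convex[of x' y' u] u
    by (auto simp: above_def intro!: bexI[of _ "\<lambda>i. (1 - u) * x' i + u * y' i"] add_mono mult_left_mono)
qed

lemma cyl_Un: "cyl n = below n \<union> above n"
proof -
  have "x \<in> below n \<union> above n" if x: "x \<in> cyl n" for x
  proof -
    obtain y where "y \<in> K" "\<forall>i<n. x i = y i" using x unfolding cyl_def by blast
    then show ?thesis by (cases "x n \<le> y n") (auto simp: below_def above_def)
  qed
  then show ?thesis by (auto simp: cyl_def below_def above_def)
qed

text \<open>Fibres of a convex set are intervals: between a point of \<open>K\<close> over the same
  prefix that lies above and one that lies below, a convex combination hits \<open>x n\<close>
  exactly.\<close>

lemma cyl_Int: "cyl (Suc n) = below n \<inter> above n"
proof -
  have "x \<in> cyl (Suc n)" if x: "x \<in> below n" "x \<in> above n" for x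
  proof -
    obtain y where y: "y \<in> K" "\<forall>i<n. x i = y i" "x n \<le> y n" using x unfolding below_def by blast
    obtain w where w: "w \<in> K" "\<forall>i<n. x i = w i" "w n \<le> x n" using x unfolding above_def by blast
    show ?thesis
    proof (cases "w n = y n")
      case True
      then show ?thesis using y w by (auto simp: cyl_def less_Suc_eq intro!: bexI[of _ y])
    next
      case False
      then have lt: "w n < y n" using y w by simp
      define u where "u = (x n - w n) / (y n - w n)"
      have u: "0 \<le> u" "u \<le> 1" using lt y w by (auto simp: u_def)
      have "u * (y n - w n) = x n - w n" using lt by (simp add: u_def)
      then have "(1 - u) * w n + u * y n = x n" by (simp add: algebra_simps)
      moreover have "(1 - u) * w i + u * y i = x i" if "i < n" for i
        using y(2) w(2) that by (simp add: algebra_simps)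
      ultimately have "\<forall>i<Suc n. x i = (1 - u) * w i + u * y i" by (auto simp: less_Suc_eq)
      then show ?thesis unfolding cyl_def using convex[OF w(1) y(1) u]
        by (intro CollectI bexI[of _ "\<lambda>i. (1 - u) * w i + u * y i"]) auto
    qed
  qed
  then show ?thesis using cyl_Suc_subset by blast
qed

lemma prefix_gauge_eq_min: "prefix_gauge n z = min (minkowski (below n) z) (minkowski (above n) z)"
  unfolding prefix_gauge_def cyl_Un
  by (rule minkowski_Un) (use convex_absorbing_below convex_absorbing_above convex_absorbing_cyl cyl_Un in auto)

lemma prefix_gauge_Suc_eq_max: "prefix_gauge (Suc n) z = max (minkowski (below n) z) (minkowski (above n) z)"
  unfolding prefix_gauge_def cyl_Int
  by (rule minkowski_Int) (use convex_absorbing_below convex_absorbing_above convex_absorbing_cyl[of "Suc n"] cyl_Int in auto)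

lemma prefix_gauge_mono: "m \<le> n \<Longrightarrow> prefix_gauge m z \<le> prefix_gauge n z"
  unfolding prefix_gauge_def by (rule minkowski_mono) (auto simp: convex_absorbing_cyl, auto simp: cyl_def)

lemma prefix_gauge_nonneg: "0 \<le> prefix_gauge n z"
  unfolding prefix_gauge_def by (rule convex_absorbing.minkowski_nonneg[OF convex_absorbing_cyl])

lemma prefix_gauge_le_one: "x \<in> K \<Longrightarrow> prefix_gauge n x \<le> 1"
  unfolding prefix_gauge_def by (rule convex_absorbing.minkowski_le[OF convex_absorbing_cyl]) (auto simp: cyl_def)

lemma prefix_gauge_cong: "(\<And>i. i < n \<Longrightarrow> z i = w i) \<Longrightarrow> prefix_gauge n z = prefix_gauge n w"
  unfolding prefix_gauge_def
  by (rule convex_absorbing.minkowski_cong[OF convex_absorbing_cyl, of _ n]) (auto simp: cyl_def)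

lemma continuous_prefix_gauge: "continuous_on UNIV (prefix_gauge n)"
  unfolding prefix_gauge_def
  by (rule convex_absorbing.continuous_minkowski[OF convex_absorbing_cyl, of _ n]) (auto simp: cyl_def)

lemma below_cong: "(\<And>i. i \<le> n \<Longrightarrow> z i = w i) \<Longrightarrow> minkowski (below n) z = minkowski (below n) w"
  by (rule convex_absorbing.minkowski_cong[OF convex_absorbing_below, of _ "Suc n"]) (auto simp: below_def)

lemma above_cong: "(\<And>i. i \<le> n \<Longrightarrow> z i = w i) \<Longrightarrow> minkowski (above n) z = minkowski (above n) w"
  by (rule convex_absorbing.minkowski_cong[OF convex_absorbing_above, of _ "Suc n"]) (auto simp: above_def)

lemma continuous_below: "continuous_on UNIV (minkowski (below n))"
  by (rule convex_absorbing.continuous_minkowski[OF convex_absorbing_below, of _ "Suc n"]) (auto simp: below_def)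

lemma continuous_above: "continuous_on UNIV (minkowski (above n))"
  by (rule convex_absorbing.continuous_minkowski[OF convex_absorbing_above, of _ "Suc n"]) (auto simp: above_def)

lemma below_scale: "0 < c \<Longrightarrow> minkowski (below n) (scale_first (Suc n) c z) = c * minkowski (below n) z"
  using below_cong[of n "scale_first (Suc n) c z" "\<lambda>i. c * z i"]
    convex_absorbing.minkowski_scale[OF convex_absorbing_below, of c n z]
  by (simp add: scale_first_def)

lemma above_scale: "0 < c \<Longrightarrow> minkowski (above n) (scale_first (Suc n) c z) = c * minkowski (above n) z"
  using above_cong[of n "scale_first (Suc n) c z" "\<lambda>i. c * z i"]
    convex_absorbing.minkowski_scale[OF convex_absorbing_above, of c n z]
  by (simp add: scale_first_def)

lemma below_mono: "s \<le> t \<Longrightarrow> minkowski (below n) (z(n := s)) \<le> minkowski (below n) (z(n := t))"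
proof (rule convex_absorbing.minkowski_leI[OF convex_absorbing_below])
  fix r assume st: "s \<le> t" and r: "minkowski (below n) (z(n := t)) < r"
  note m = convex_absorbing.minkowski_less[OF convex_absorbing_below r]
  obtain y where y: "y \<in> K" "\<forall>i<n. (z(n := t)) i / r = y i" "(z(n := t)) n / r \<le> y n"
    using m(2) by (auto simp: below_def)
  have "s / r \<le> t / r" using st m(1) by (simp add: divide_right_mono)
  then show "0 < r \<and> (\<lambda>i. (z(n := s)) i / r) \<in> below n"
    using m(1) y by (auto simp: below_def intro!: bexI[of _ y])
qed

lemma above_antimono: "s \<le> t \<Longrightarrow> minkowski (above n) (z(n := t)) \<le> minkowski (above n) (z(n := s))"
proof (rule convex_absorbing.minkowski_leI[OF convex_absorbing_above])
  fix r assume st: "s \<le> t" and r: "minkowski (above n) (z(n := s)) < r"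
  note m = convex_absorbing.minkowski_less[OF convex_absorbing_above r]
  obtain y where y: "y \<in> K" "\<forall>i<n. (z(n := s)) i / r = y i" "y n \<le> (z(n := s)) n / r"
    using m(2) by (auto simp: above_def)
  have "s / r \<le> t / r" using st m(1) by (simp add: divide_right_mono)
  then show "0 < r \<and> (\<lambda>i. (z(n := t)) i / r) \<in> above n"
    using m(1) y by (auto simp: above_def intro!: bexI[of _ y])
qed

text \<open>A bound for coordinate i on \<open>K\<close> passes to every gauge that sees this
  coordinate, with one constant for all n. In particular gauge zero forces the whole prefix to
  vanish, as the radial maps require.\<close>

lemma coordinate_bound: "\<exists>M>0. \<forall>n z. i < n \<longrightarrow> \<bar>z i\<bar> \<le> M * prefix_gauge n z"
proof -
  obtain M0 where M0: "\<forall>x\<in>K. \<bar>x i\<bar> \<le> M0" using bounded by blast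
  define M where "M = max M0 1"
  have M: "M > 0" "\<forall>x\<in>K. \<bar>x i\<bar> \<le> M" using M0 by (auto simp: M_def)
  have "\<bar>z i\<bar> \<le> M * prefix_gauge n z" if i: "i < n" for n z
  proof -
    have "\<bar>z i\<bar> / M \<le> prefix_gauge n z"
    proof (rule dense_ge)
      fix s assume "prefix_gauge n z < s"
      note m = convex_absorbing.minkowski_less[OF convex_absorbing_cyl this[unfolded prefix_gauge_def]]
      obtain y where "y \<in> K" "z i / s = y i" using m(2) i by (auto simp: cyl_def)
      then have "\<bar>z i / s\<bar> \<le> M" using M by metis
      then show "\<bar>z i\<bar> / M \<le> s" using m(1) M(1) by (simp add: field_simps)
    qed
    then show ?thesis using M(1) by (simp add: field_simps)
  qed
  then show ?thesis using M(1) by blast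
qed

end

section \<open>Trading one coordinate of the body for a cube factor\<close>

lemma continuous_on_fun_upd:
  assumes "continuous_on S f" "continuous_on S g"
  shows "continuous_on S (\<lambda>x. (f x :: nat \<Rightarrow> real)(n := g x))"
proof (rule continuous_on_coordinatewise_then_product)
  fix i
  show "continuous_on S (\<lambda>x. ((f x)(n := g x)) i)"
    using assms continuous_on_product_then_coordinatewise[OF assms(1)] by (cases "i = n") auto
qed

context keller_body
begin

text \<open>
  Over a prefix \<open>x\<close>, the functions \<open>U\<close> and \<open>D\<close> of the next coordinate \<open>t\<close> are increasing and decreasing,
  their minimum is the gauge of \<open>x\<close> and their maximum is the gauge of \<open>(x, t)\<close>. Hence the signed
  difference \<open>U - D\<close> (made strictly monotone by the term \<open>\<epsilon> t\<close>) straightens the body to the double cone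
  \<open>q + \<bar>v\<bar> \<le> 1\<close>; a vertical stretch turns this into \<open>max \<bar>s\<bar> (q + \<theta> \<bar>s\<bar>) \<le> 1\<close>,
  which is radially close to the cylinder \<open>max q \<bar>s\<bar> \<le> 1\<close>.
\<close>

lemma near_homeo:
  assumes \<delta>: "0 < \<delta>"
  shows "\<exists>\<Phi>. bij_betw \<Phi> (partial_cube (Suc n)) (partial_cube n) \<and> continuous_on (partial_cube (Suc n)) \<Phi> \<and>
    (\<forall>z\<in>partial_cube (Suc n). \<forall>i<n. \<bar>\<Phi> z i - z i\<bar> \<le> \<delta>) \<and> (\<forall>z. \<forall>i>n. \<Phi> z i = z i) \<and>
    (\<forall>z w. (\<forall>j\<le>n. z j = w j) \<longrightarrow> (\<forall>i\<le>n. \<Phi> z i = \<Phi> w i))"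
proof -
  obtain M where M: "\<And>i. M i > 0" "\<And>i m z. i < m \<Longrightarrow> \<bar>z i\<bar> \<le> M i * prefix_gauge m z"
    using coordinate_bound by metis
  define B where "B = (\<Sum>i\<le>n. M i)"
  have MB: "M i \<le> B" if "i \<le> n" for i
    unfolding B_def using that M(1) by (intro member_le_sum) (auto intro: less_imp_le)
  have B: "B > 0" using MB[of n] M(1)[of n] by simp
  have bnd: "\<bar>z i\<bar> \<le> B * prefix_gauge (Suc n) z" if "i \<le> n" for i z
    using M(2)[of i "Suc n" z] MB[OF that] mult_right_mono[OF MB[OF that] prefix_gauge_nonneg[of "Suc n" z]] that by simp
  \<comment> \<open>The two radial steps multiply the first n coordinates by a total factor within 4
    \<theta> of 1, and these coordinates are at most \<open>B\<close>, so they move by at most 4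
    \<theta> B. The cap 1/2 controls the quotients of gauges.\<close>
  define \<theta> where "\<theta> = min (1/2) (\<delta> / (4 * B))"
  have \<theta>: "0 < \<theta>" "\<theta> \<le> 1/2" "4 * \<theta> * B \<le> \<delta>"
    using \<delta> B by (auto simp: \<theta>_def min_def field_simps)
  \<comment> \<open>With this tilt the term \<open>\<epsilon> * z n\<close> is at most \<theta>
    times the gauge \<open>P\<close>, so \<open>P'\<close> stays within the factors 1 - \<theta> and
    1 + \<theta> of \<open>P\<close>.\<close>
  define \<epsilon> where "\<epsilon> = \<theta> / B"
  have \<epsilon>: "\<epsilon> > 0" "\<epsilon> * B = \<theta>" using \<theta> B by (auto simp: \<epsilon>_def)
  define U D where "U = minkowski (below n)" and "D = minkowski (above n)"
  define P q where "P = prefix_gauge (Suc n)" and "q = prefix_gauge n"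
  define V where "V = (\<lambda>z. U z - D z + \<epsilon> * z n)"
  define P' where "P' = (\<lambda>z. q z + \<bar>V z\<bar>)"
  define Q1 where "Q1 = (\<lambda>z. max \<bar>z n\<bar> (q z + \<theta> * \<bar>z n\<bar>))"
  define Q2 where "Q2 = (\<lambda>z. max (q z) \<bar>z n\<bar>)"
  define R where "R = (\<lambda>z :: nat \<Rightarrow> real. \<forall>i>n. \<bar>z i\<bar> \<le> 1)"
  define f1 where "f1 = (\<lambda>z. scale_first (Suc n) (P z / P' z) z)"
  \<comment> \<open>Measured by \<open>V\<close>, the fibre of the double cone has half-length 1 -
    q. Dividing by this alone would fail at the rim q = 1; the floor \<theta> prevents that and is
    the origin of the term \<open>\<theta> * \<bar>z n\<bar>\<close> in \<open>Q1\<close>.\<close>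
  define f2 where "f2 = (\<lambda>z :: nat \<Rightarrow> real. z(n := V z / max (1 - q z) \<theta>))"
  define f3 where "f3 = (\<lambda>z. scale_first (Suc n) (Q1 z / Q2 z) z)"
  have qmin: "q z = min (U z) (D z)" for z unfolding q_def U_def D_def by (rule prefix_gauge_eq_min)
  have Pmax: "P z = max (U z) (D z)" for z unfolding P_def U_def D_def by (rule prefix_gauge_Suc_eq_max)
  have q0: "q z \<ge> 0" and P0: "P z \<ge> 0" for z by (simp_all add: q_def P_def prefix_gauge_nonneg)
  have qP: "q z \<le> P z" for z by (simp add: qmin Pmax)
  have cong: "U z = U w" "D z = D w" "P z = P w" "V z = V w" "q z = q w"
    if "\<forall>j\<le>n. z j = w j" for z w
    using that below_cong[of n z w] above_cong[of n z w]
    by (auto simp: U_def D_def V_def Pmax qmin)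
  have qcong: "q z = q w" if "\<And>j. j < n \<Longrightarrow> z j = w j" for z w
    unfolding q_def by (rule prefix_gauge_cong) (use that in auto)
  have cont: "continuous_on S U" "continuous_on S D" "continuous_on S q" "continuous_on S P" for S
    using continuous_below[of n] continuous_above[of n] continuous_prefix_gauge[of n] continuous_prefix_gauge[of "Suc n"]
    by (auto simp: U_def D_def q_def P_def intro: continuous_on_subset)
  have contV: "continuous_on S V" for S
    unfolding V_def by (intro continuous_intros cont continuous_on_coordinate)
  have sc: "U (scale_first (Suc n) c z) = c * U z" "D (scale_first (Suc n) c z) = c * D z" if "0 < c" for c z
    using below_scale[OF that] above_scale[OF that] by (auto simp: U_def D_def)
  have scn: "scale_first (Suc n) c z n = c * z n" for c z by (simp add: scale_first_def)
  have scq: "q (scale_first (Suc n) c z) = c * q z" and scP: "P (scale_first (Suc n) c z) = c * P z"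
    and scV: "V (scale_first (Suc n) c z) = c * V z" if "0 < c" for c z
    using that by (auto simp: qmin Pmax V_def sc scn min_def max_def algebra_simps)
  have scP': "P' (scale_first (Suc n) c z) = c * P' z"
    and scQ1: "Q1 (scale_first (Suc n) c z) = c * Q1 z"
    and scQ2: "Q2 (scale_first (Suc n) c z) = c * Q2 z" if c: "0 < c" for c z
  proof -
    have mx: "max (c * a) (c * b) = c * max a b" for a b using c by (simp add: max_def)
    show "P' (scale_first (Suc n) c z) = c * P' z"
      using c by (simp add: P'_def scq scV abs_mult distrib_left)
    have "c * q z + \<theta> * (c * \<bar>z n\<bar>) = c * (q z + \<theta> * \<bar>z n\<bar>)" by (simp add: algebra_simps)
    then show "Q1 (scale_first (Suc n) c z) = c * Q1 z"
      using c by (simp add: Q1_def scq scn abs_mult mx)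
    show "Q2 (scale_first (Suc n) c z) = c * Q2 z"
      using c by (simp add: Q2_def scq scn abs_mult mx)
  qed
  have PP': "\<bar>P' z - P z\<bar> \<le> \<theta> * P z" for z
  proof -
    have "P z = q z + \<bar>U z - D z\<bar>" by (simp add: qmin Pmax min_def max_def)
    then have "\<bar>P' z - P z\<bar> \<le> \<bar>\<epsilon> * z n\<bar>" unfolding P'_def V_def by linarith
    also have "\<dots> = \<epsilon> * \<bar>z n\<bar>" using \<epsilon> by (simp add: abs_mult)
    also have "\<dots> \<le> \<epsilon> * (B * P z)" using bnd[of n z] \<epsilon>(1) by (auto simp: P_def intro!: mult_left_mono)
    also have "\<dots> = \<theta> * P z" using \<epsilon>(2) by (simp add: mult.assoc[symmetric])
    finally show ?thesis .
  qed
  have P'lo: "P z * (1 - \<theta>) \<le> P' z" and P'hi: "P' z \<le> P z * (1 + \<theta>)" for z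
    using PP'[of z] by (simp_all add: algebra_simps abs_le_iff)
  have P'0: "0 \<le> P' z" for z using q0 by (simp add: P'_def)
  have zeroP: "P z = 0 \<longleftrightarrow> P' z = 0" for z
  proof
    assume "P' z = 0"
    then have "P z * (1 - \<theta>) \<le> 0" using P'lo[of z] by simp
    then show "P z = 0" using P0[of z] \<theta> by (simp add: mult_le_0_iff)
  next
    assume "P z = 0"
    then show "P' z = 0" using P'hi[of z] P'0[of z] by simp
  qed
  have zeroP': "P z = 0 \<Longrightarrow> i < Suc n \<Longrightarrow> z i = 0" for z i
    using bnd[of i z] by (simp add: P_def)
  have ratio1: "1 - \<theta> \<le> P z / P' z" "P z / P' z \<le> 1 + 2 * \<theta>" if "P z \<noteq> 0" for z
  proof -
    have pos: "P z > 0" "P' z > 0" using that zeroP[of z] P0[of z] P'0[of z] by (auto simp: less_le)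
    have "(1 - \<theta>) * P' z \<le> (1 - \<theta>) * (P z * (1 + \<theta>))"
      using P'hi[of z] \<theta> by (intro mult_left_mono) auto
    also have "\<dots> = P z - \<theta> * \<theta> * P z" by (simp add: algebra_simps)
    also have "\<dots> \<le> P z" using pos \<theta> by simp
    finally show "1 - \<theta> \<le> P z / P' z" using pos by (simp add: pos_le_divide_eq)
    have "(1 + 2 * \<theta>) * (P z * (1 - \<theta>)) \<le> (1 + 2 * \<theta>) * P' z"
      using P'lo[of z] \<theta> by (intro mult_left_mono) auto
    moreover have "(1 + 2 * \<theta>) * (P z * (1 - \<theta>)) = P z + \<theta> * (1 - 2 * \<theta>) * P z"
      by (simp add: algebra_simps)
    moreover have "0 \<le> \<theta> * (1 - 2 * \<theta>) * P z" using pos \<theta> by simp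
    ultimately have "P z \<le> (1 + 2 * \<theta>) * P' z" by linarith
    then show "P z / P' z \<le> 1 + 2 * \<theta>" using pos by (simp add: pos_divide_le_eq)
  qed
  have Q20: "0 \<le> Q2 z" for z using q0 by (auto simp: Q2_def le_max_iff_disj)
  have Q10: "0 \<le> Q1 z" for z by (auto simp: Q1_def le_max_iff_disj)
  have Q21: "Q2 z \<le> Q1 z" for z
  proof -
    have "0 \<le> \<theta> * \<bar>z n\<bar>" using \<theta> by simp
    then show ?thesis by (auto simp: Q1_def Q2_def)
  qed
  have Q12: "Q1 z \<le> (1 + \<theta>) * Q2 z" for z
  proof -
    have "\<theta> * \<bar>z n\<bar> \<le> \<theta> * Q2 z" using \<theta> by (intro mult_left_mono) (auto simp: Q2_def)
    moreover have "q z \<le> Q2 z" "\<bar>z n\<bar> \<le> Q2 z" by (auto simp: Q2_def)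
    moreover have "0 \<le> \<theta> * Q2 z" using \<theta> Q20 by simp
    ultimately show ?thesis unfolding Q1_def by (auto simp: algebra_simps)
  qed
  have zeroQ: "Q1 z = 0 \<longleftrightarrow> Q2 z = 0" for z
    using Q12[of z] Q21[of z] Q10[of z] Q20[of z] by auto
  have zeroQ': "z i = 0" if "Q2 z = 0" "i < Suc n" for z i
  proof -
    have "q z = 0" "z n = 0" using that(1) q0[of z] by (auto simp: Q2_def max_def split: if_splits)
    then show ?thesis using that(2) M(2)[of i n z] by (cases "i = n") (auto simp: q_def)
  qed
  have ratio2: "1 \<le> Q1 z / Q2 z" "Q1 z / Q2 z \<le> 1 + \<theta>" if "Q2 z \<noteq> 0" for z
    using that Q20[of z] Q21[of z] Q12[of z] by (auto simp: less_le pos_divide_le_eq pos_le_divide_eq)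
  have Rsc: "R (scale_first (Suc n) c z) = R z" for c z by (auto simp: R_def scale_first_def)
  have bij1: "bij_betw f1 {z. P z \<le> 1 \<and> R z} {z. P' z \<le> 1 \<and> R z}"
    unfolding f1_def by (rule radial_bij) (use scP scP' P0 P'0 zeroP zeroP' Rsc in auto)
  have bij3: "bij_betw f3 {z. Q1 z \<le> 1 \<and> R z} {z. Q2 z \<le> 1 \<and> R z}"
    unfolding f3_def by (rule radial_bij) (use scQ1 scQ2 Q10 Q20 zeroQ zeroQ' Rsc in auto)
  have mono: "V (z(n := s)) < V (z(n := t))" if "s < t" for z s t
  proof -
    have "U (z(n := s)) \<le> U (z(n := t))" "D (z(n := t)) \<le> D (z(n := s))"
      using below_mono[of s t n z] above_antimono[of s t n z] that by (simp_all add: U_def D_def)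
    moreover have "\<epsilon> * s < \<epsilon> * t" using that \<epsilon>(1) by (rule mult_strict_left_mono)
    moreover have "V (z(n := r)) = U (z(n := r)) - D (z(n := r)) + \<epsilon> * r" for r by (simp add: V_def)
    ultimately show ?thesis by (metis add_le_less_mono diff_mono)
  qed
  have bij2: "bij_betw f2 {z. P' z \<le> 1 \<and> R z} {z. Q1 z \<le> 1 \<and> R z}"
  proof (rule bij_betw_imageI)
    \<comment> \<open>\<open>q\<close> ignores coordinate n, the only one that \<open>f2\<close>
      changes. Points with equal images therefore have the same divisor, and strict monotonicity of
      \<open>V\<close> in that coordinate separates them.\<close>
    show "inj_on f2 {z. P' z \<le> 1 \<and> R z}"
    proof (rule inj_onI)
      fix z w assume eq: "f2 z = f2 w"
      have off: "z i = w i" if "i \<noteq> n" for i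
        using fun_cong[OF eq, of i] that by (simp add: f2_def)
      have "q z = q w" by (rule qcong) (use off in auto)
      moreover have "max (1 - q w) \<theta> > 0" using \<theta> by simp
      ultimately have Veq: "V z = V w" using fun_cong[OF eq, of n] by (simp add: f2_def)
      have zw: "w = z(n := w n)" using off by auto
      have "z n = w n"
        using mono[of "z n" "w n" z] mono[of "w n" "z n" z] Veq zw by (metis fun_upd_triv less_irrefl linorder_neqE)
      with off show "z = w" by (metis ext)
    qed
    have "f2 z \<in> {z. Q1 z \<le> 1 \<and> R z}" if z: "P' z \<le> 1" "R z" for z
    proof -
      define m where "m = max (1 - q z) \<theta>"
      have m: "m > 0" "1 - q z \<le> m" "\<theta> \<le> m" using \<theta> by (auto simp: m_def)
      have v: "\<bar>V z\<bar> \<le> 1 - q z" using z by (simp add: P'_def)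
      have qf: "q (f2 z) = q z" by (rule qcong) (simp add: f2_def)
      have fn: "f2 z n = V z / m" by (simp add: f2_def m_def)
      have "\<bar>V z\<bar> / m \<le> 1" using v m by (simp add: divide_le_eq)
      moreover have "\<theta> * (\<bar>V z\<bar> / m) \<le> \<bar>V z\<bar>"
        using mult_right_mono[OF m(3), of "\<bar>V z\<bar>"] m(1) by (simp add: divide_le_eq mult.commute)
      moreover have "\<bar>f2 z n\<bar> = \<bar>V z\<bar> / m" using m(1) by (simp add: fn)
      ultimately have "Q1 (f2 z) \<le> 1" using v unfolding Q1_def qf by simp
      then show ?thesis using z by (auto simp: R_def f2_def)
    qed
    moreover have "\<exists>z. P' z \<le> 1 \<and> R z \<and> f2 z = w" if w: "Q1 w \<le> 1" "R w" for w
    proof -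
      define m where "m = max (1 - q w) \<theta>"
      have m: "m > 0" using \<theta> by (auto simp: m_def)
      define v where "v = w n * m"
      define c where "c = U (w(n := 0)) - D (w(n := 0))"
      \<comment> \<open>At height t the tilt outweighs both \<open>v\<close> and the offset
        \<open>c\<close>, because U - D is nondecreasing in the coordinate. The value
        \<open>v\<close> is then attained between -t and t.\<close>
      define t where "t = (\<bar>v\<bar> + \<bar>c\<bar>) / \<epsilon>"
      have t: "t \<ge> 0" "\<epsilon> * t = \<bar>v\<bar> + \<bar>c\<bar>" using \<epsilon> by (auto simp: t_def)
      have "c + \<epsilon> * t \<le> V (w(n := t))"
        using below_mono[OF t(1), of n w] above_antimono[OF t(1), of n w] by (auto simp: V_def U_def D_def c_def)
      then have hi: "v \<le> V (w(n := t))" using t(2) by linarith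
      have t': "- t \<le> 0" using t(1) by simp
      have "V (w(n := - t)) \<le> c - \<epsilon> * t"
        using below_mono[OF t', of n w] above_antimono[OF t', of n w] by (auto simp: V_def U_def D_def c_def)
      then have lo: "V (w(n := - t)) \<le> v" using t(2) by linarith
      have "continuous_on {-t..t} (\<lambda>r. V (w(n := r)))"
        by (rule continuous_on_compose2[OF contV[of UNIV] continuous_on_fun_upd[OF continuous_on_const continuous_on_id]]) simp
      then obtain r where r: "V (w(n := r)) = v"
        using IVT'[of "\<lambda>r. V (w(n := r))" "- t" v t] lo hi t by auto
      define z where "z = w(n := r)"
      have qz: "q z = q w" by (rule qcong) (simp add: z_def)
      have Q: "\<bar>w n\<bar> \<le> 1" "q w + \<theta> * \<bar>w n\<bar> \<le> 1" using w(1) by (auto simp: Q1_def)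
      have "\<bar>v\<bar> \<le> 1 - q w"
      proof (cases "1 - q w \<ge> \<theta>")
        case True
        then have "\<bar>v\<bar> = \<bar>w n\<bar> * (1 - q w)" using \<theta> by (simp add: v_def m_def abs_mult)
        then show ?thesis using mult_right_mono[OF Q(1), of "1 - q w"] True \<theta> by simp
      next
        case False
        then have "\<bar>v\<bar> = \<theta> * \<bar>w n\<bar>" using \<theta> by (simp add: v_def m_def abs_mult)
        then show ?thesis using Q(2) by simp
      qed
      then have "P' z \<le> 1" using r qz by (simp add: P'_def z_def)
      moreover have "R z" using w(2) by (simp add: R_def z_def)
      moreover have "f2 z = w"
        using r m unfolding f2_def qz m_def[symmetric] by (auto simp: z_def v_def)
      ultimately show ?thesis by blast
    qed
    ultimately show "f2 ` {z. P' z \<le> 1 \<and> R z} = {z. Q1 z \<le> 1 \<and> R z}" by blast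
  qed
  define \<Phi> where "\<Phi> = f3 \<circ> (f2 \<circ> f1)"
  have ZS: "partial_cube (Suc n) = {z. P z \<le> 1 \<and> R z}" by (auto simp: partial_cube_def P_def R_def Suc_le_eq)
  have Zn: "partial_cube n = {z. Q2 z \<le> 1 \<and> R z}"
    by (auto simp: partial_cube_def Q2_def R_def q_def le_less)
  have "bij_betw \<Phi> (partial_cube (Suc n)) (partial_cube n)"
    unfolding ZS Zn \<Phi>_def by (rule bij_betw_trans[OF bij_betw_trans[OF bij1 bij2] bij3])
  moreover have "continuous_on (partial_cube (Suc n)) \<Phi>"
  proof -
    have "P z \<le> 2 * P' z" for z
    proof -
      have "P z * (1/2) \<le> P z * (1 - \<theta>)" using \<theta> P0 by (intro mult_left_mono) auto
      then show ?thesis using P'lo[of z] by simp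
    qed
    then have c1: "continuous_on UNIV f1"
      unfolding f1_def
      by (intro radial_continuous[where A = 2])
         (use zeroP zeroP' P0 P'0 cont contV in \<open>auto simp: P'_def intro!: continuous_intros\<close>)
    have c2: "continuous_on UNIV f2"
      unfolding f2_def
      by (intro continuous_on_fun_upd continuous_intros contV cont) (use \<theta> in \<open>auto simp: max_def\<close>)
    have c3: "continuous_on UNIV f3"
      unfolding f3_def
      by (intro radial_continuous[where A = "1 + \<theta>"])
         (use zeroQ' Q10 Q20 Q12 cont in \<open>auto simp: Q1_def[abs_def] Q2_def[abs_def] intro!: continuous_intros continuous_on_coordinate\<close>)
    have "continuous_on UNIV \<Phi>"
      unfolding \<Phi>_def
      by (intro continuous_on_compose c1 continuous_on_subset[OF c2] continuous_on_subset[OF c3]) auto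
    then show ?thesis by (rule continuous_on_subset) simp
  qed
  \<comment> \<open>\<open>f2\<close> leaves the coordinates below n alone, so these are only
    multiplied by the two radial quotients. The case \<open>z i = 0\<close> is split off because the
    bounds on the quotients require nonzero gauges.\<close>
  moreover have "\<bar>\<Phi> z i - z i\<bar> \<le> \<delta>" if z: "z \<in> partial_cube (Suc n)" and i: "i < n" for z i
  proof (cases "z i = 0")
    case True
    then show ?thesis using i \<delta> by (simp add: \<Phi>_def f1_def f2_def f3_def scale_first_def)
  next
    case False
    have Pz: "P z \<noteq> 0" using False zeroP'[of z i] i by auto
    define r where "r = P z / P' z"
    define s where "s = Q1 (f2 (f1 z)) / Q2 (f2 (f1 z))"
    have \<Phi>i: "\<Phi> z i = s * (r * z i)"
      using i by (simp add: \<Phi>_def f1_def f2_def f3_def scale_first_def r_def s_def)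
    have r: "1 - \<theta> \<le> r" "r \<le> 1 + 2 * \<theta>" using ratio1[OF Pz] by (auto simp: r_def)
    have "f2 (f1 z) i = r * z i" using i by (simp add: f1_def f2_def scale_first_def r_def)
    then have "f2 (f1 z) i \<noteq> 0" using False r \<theta> by auto
    then have "Q2 (f2 (f1 z)) \<noteq> 0" using zeroQ' i by (metis less_SucI)
    then have s: "1 \<le> s" "s \<le> 1 + \<theta>" using ratio2 by (auto simp: s_def)
    have "1 * (1 - \<theta>) \<le> s * r" using r s \<theta> by (intro mult_mono) auto
    moreover have "s * r \<le> 1 + 4 * \<theta>"
    proof -
      have "s * r \<le> (1 + \<theta>) * (1 + 2 * \<theta>)" using r s \<theta> by (intro mult_mono) auto
      also have "\<dots> \<le> 1 + 4 * \<theta>"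
        using mult_left_mono[OF \<theta>(2), of "2 * \<theta>"] \<theta> by (simp add: algebra_simps)
      finally show ?thesis .
    qed
    ultimately have "1 - \<theta> \<le> s * r" "s * r \<le> 1 + 4 * \<theta>" by simp_all
    then have sr: "\<bar>s * r - 1\<bar> \<le> 4 * \<theta>" using \<theta>(1) by (intro abs_leI) linarith+
    have "P z \<le> 1" using z by (simp add: ZS)
    then have "B * P z \<le> B * 1" using B by (intro mult_left_mono) auto
    then have zi: "\<bar>z i\<bar> \<le> B" using bnd[of i z] i by (simp add: P_def)
    have "\<Phi> z i - z i = (s * r - 1) * z i" by (simp add: \<Phi>i algebra_simps)
    then have "\<bar>\<Phi> z i - z i\<bar> = \<bar>s * r - 1\<bar> * \<bar>z i\<bar>" by (simp add: abs_mult)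
    also have "\<dots> \<le> 4 * \<theta> * B" using sr zi \<theta> by (intro mult_mono) auto
    finally show ?thesis using \<theta>(3) by simp
  qed
  moreover have "\<Phi> z i = z i" if "i > n" for z i
    using that by (simp add: \<Phi>_def f1_def f2_def f3_def scale_first_def)
  \<comment> \<open>This locality later turns uniform continuity of \<open>\<Phi>\<close> into a
    modulus that involves finitely many coordinates only.\<close>
  moreover have "\<Phi> z i = \<Phi> w i" if zw: "\<forall>j\<le>n. z j = w j" and i: "i \<le> n" for z w i
  proof -
    have "P' z = P' w" using cong[OF zw] by (simp add: P'_def)
    then have 1: "\<forall>j\<le>n. f1 z j = f1 w j" using zw cong[OF zw] by (simp add: f1_def scale_first_def)
    have 2: "\<forall>j\<le>n. f2 (f1 z) j = f2 (f1 w) j" using 1 cong[OF 1] by (simp add: f2_def)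
    show ?thesis using i 2 cong[OF 2] by (simp add: \<Phi>_def f3_def scale_first_def Q1_def Q2_def)
  qed
  ultimately show ?thesis by blast
qed

end

section \<open>Convergence, compactness and uniform continuity for real sequences\<close>

lemma tendsto_coordinatewise:
  fixes f :: "'a \<Rightarrow> nat \<Rightarrow> real"
  assumes "\<And>i. ((\<lambda>n. f n i) \<longlongrightarrow> l i) F"
  shows "(f \<longlongrightarrow> l) F"
  using limitin_componentwise[of "\<lambda>i. euclidean" UNIV f l F] assms
  by (simp add: euclidean_product_topology)

text \<open>The metric on sequences weights the capped coordinate distances by powers of 1/2, which
  sum to 2.\<close>

lemma dist_fun_le:
  fixes x y :: "nat \<Rightarrow> real"
  assumes "\<And>i. \<bar>x i - y i\<bar> \<le> d"
  shows "dist x y \<le> 2 * d"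
proof -
  have g: "(\<lambda>n. (1 / 2) ^ n * d) sums (2 * d)"
    using sums_mult2[OF geometric_sums[of "1/2 :: real"], of d] by simp
  have le: "(1 / 2) ^ n * min (dist (x (from_nat n)) (y (from_nat n))) 1 \<le> (1 / 2) ^ n * d" for n
    using assms[of "from_nat n"] by (intro mult_left_mono) (auto simp: dist_real_def)
  have "summable (\<lambda>n. (1 / 2 :: real) ^ n * min (dist (x (from_nat n)) (y (from_nat n))) 1)"
    by (rule summable_comparison_test[OF _ sums_summable[OF g]]) (use le in \<open>auto simp: abs_mult\<close>)
  from suminf_le[OF le this sums_summable[OF g]] show ?thesis
    using sums_unique[OF g] by (simp add: dist_fun_def)
qed

lemma compact_coordinatewise_bounded:
  fixes S :: "(nat \<Rightarrow> real) set"
  assumes "closed S" "\<And>z i. z \<in> S \<Longrightarrow> \<bar>z i\<bar> \<le> B i"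
  shows "compact S"
proof -
  have "compactin (product_topology (\<lambda>i. euclidean) UNIV) (PiE UNIV (\<lambda>i. {- B i..B i}))"
    unfolding compactin_PiE by simp
  then have "compact (PiE UNIV (\<lambda>i. {- B i..B i}))" by (simp add: euclidean_product_topology)
  moreover have "S \<subseteq> PiE UNIV (\<lambda>i. {- B i..B i})"
    using assms(2) by (force simp: abs_le_iff)
  ultimately show ?thesis using assms(1) by (metis compact_Int_closed inf.absorb_iff2)
qed

text \<open>The product metric also sees the tails, which closeness of prefixes does not control.
  Replacing both tails by 0 stays inside \<open>S\<close> and, by \<open>dep\<close>, does not
  change the first \<open>N\<close> values.\<close>

lemma prefix_uniformly_continuous:
  fixes \<Phi> :: "(nat \<Rightarrow> real) \<Rightarrow> (nat \<Rightarrow> real)"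
  assumes S: "compact S" and \<Phi>: "continuous_on S \<Phi>"
    and tr: "\<And>z. z \<in> S \<Longrightarrow> (\<lambda>i. if i < N then z i else 0) \<in> S"
    and dep: "\<And>z w i. (\<And>j. j < N \<Longrightarrow> z j = w j) \<Longrightarrow> i < N \<Longrightarrow> \<Phi> z i = \<Phi> w i"
    and \<eta>: "0 < \<eta>"
  shows "\<exists>d>0. \<forall>z\<in>S. \<forall>w\<in>S. (\<forall>i<N. \<bar>z i - w i\<bar> \<le> d) \<longrightarrow> (\<forall>i<N. \<bar>\<Phi> z i - \<Phi> w i\<bar> \<le> \<eta>)"
proof -
  have "\<exists>e>0. \<forall>z\<in>S. \<forall>w\<in>S. dist z w < e \<longrightarrow> \<bar>\<Phi> z i - \<Phi> w i\<bar> \<le> \<eta>" for i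
  proof -
    have "uniformly_continuous_on S (\<lambda>z. \<Phi> z i)"
      by (rule compact_uniformly_continuous[OF continuous_on_product_then_coordinatewise[OF \<Phi>] S])
    then show ?thesis using \<eta> unfolding uniformly_continuous_on_def dist_real_def
      by (metis less_imp_le dist_commute)
  qed
  then obtain e where e: "\<And>i. e i > 0"
     "\<And>i z w. z \<in> S \<Longrightarrow> w \<in> S \<Longrightarrow> dist z w < e i \<Longrightarrow> \<bar>\<Phi> z i - \<Phi> w i\<bar> \<le> \<eta>"
    by metis
  \<comment> \<open>Truncated points within d in each coordinate have distance at most 2 d; a
    quarter of the minimum makes this strictly smaller than each \<open>e i\<close>. The element 1
    keeps the set nonempty when \<open>N\<close> is 0.\<close>
  define d where "d = Min (insert 1 (e ` {..<N})) / 4"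
  have d: "d > 0" "\<And>i. i < N \<Longrightarrow> 2 * d < e i"
  proof -
    have m: "Min (insert 1 (e ` {..<N})) > 0" using e(1) by simp
    then show "d > 0" by (simp add: d_def)
    show "2 * d < e i" if "i < N" for i
    proof -
      have "Min (insert 1 (e ` {..<N})) \<le> e i" using that by (intro Min_le) auto
      then show ?thesis using m unfolding d_def by linarith
    qed
  qed
  have "\<bar>\<Phi> z i - \<Phi> w i\<bar> \<le> \<eta>"
    if z: "z \<in> S" and w: "w \<in> S" and close: "\<forall>i<N. \<bar>z i - w i\<bar> \<le> d" and i: "i < N" for z w i
  proof -
    let ?T = "\<lambda>z i. if i < N then z i else (0::real)"
    have "dist (?T z) (?T w) \<le> 2 * d"
      using close d(1) by (intro dist_fun_le) auto
    then have "\<bar>\<Phi> (?T z) i - \<Phi> (?T w) i\<bar> \<le> \<eta>"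
      using d(2)[OF i] by (intro e(2) tr z w) auto
    moreover have "\<Phi> (?T z) i = \<Phi> z i" "\<Phi> (?T w) i = \<Phi> w i" by (rule dep; use i in simp)+
    ultimately show ?thesis by simp
  qed
  then show ?thesis using d(1) by blast
qed

section \<open>Keller's theorem as a limit of finite stages\<close>

context keller_body
begin

lemma closed_partial_cube: "closed (partial_cube n)"
proof -
  have "closed {z. prefix_gauge n z \<le> 1}"
    by (intro closed_Collect_le continuous_prefix_gauge continuous_on_const)
  moreover have "closed {z :: nat \<Rightarrow> real. \<forall>i. i \<ge> n \<longrightarrow> \<bar>z i\<bar> \<le> 1}"
    by (intro closed_Collect_all closed_Collect_imp closed_Collect_le continuous_intros continuous_on_coordinate) auto
  ultimately show ?thesis
    unfolding partial_cube_def by (simp add: Collect_conj_eq closed_Int)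
qed

lemma compact_partial_cube: "compact (partial_cube n)"
proof -
  obtain M where M: "\<And>i. M i > 0" "\<And>i m z. i < m \<Longrightarrow> \<bar>z i\<bar> \<le> M i * prefix_gauge m z"
    using coordinate_bound by metis
  have "\<bar>z i\<bar> \<le> max (M i) 1" if z: "z \<in> partial_cube n" for z i
  proof (cases "i < n")
    case True
    have "M i * prefix_gauge n z \<le> M i * 1" using z M(1)[of i] by (intro mult_left_mono) (auto simp: partial_cube_def)
    then show ?thesis using M(2)[OF True, of z] by simp
  next
    case False
    then have "\<bar>z i\<bar> \<le> 1" using z by (simp add: partial_cube_def)
    then show ?thesis by linarith
  qed
  with closed_partial_cube show ?thesis by (rule compact_coordinatewise_bounded)
qed

lemma partial_cube_0: "partial_cube 0 = {z. \<forall>i. \<bar>z i\<bar> \<le> 1}"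
proof -
  have "prefix_gauge 0 z \<le> 1" for z
    unfolding prefix_gauge_def using zero_mem
    by (intro convex_absorbing.minkowski_le[OF convex_absorbing_cyl]) (auto simp: cyl_def)
  then show ?thesis by (auto simp: partial_cube_def)
qed

lemma truncate_partial_cube: "prefix_gauge n z \<le> 1 \<Longrightarrow> (\<lambda>i. if i < n then z i else 0) \<in> partial_cube n"
  using prefix_gauge_cong[of n "\<lambda>i. if i < n then z i else 0" z] by (auto simp: partial_cube_def)

text \<open>Gauge at most 1 yields prefixes of points of \<open>K\<close> only after shrinking by a
  factor slightly below 1. As the prefix grows and the factor tends to 1, the chosen points of
  \<open>K\<close> converge to \<open>x\<close>, and \<open>K\<close> is closed.\<close>

lemma prefix_gauge_le_one_imp_mem: assumes "\<And>n. prefix_gauge n x \<le> 1" shows "x \<in> K"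
proof -
  have "\<exists>y\<in>K. \<forall>i<n. x i = (1 + inverse (real (Suc n))) * y i" for n
  proof -
    have "minkowski (cyl n) x < 1 + inverse (real (Suc n))" using assms[of n] by (simp add: prefix_gauge_def add_strict_increasing2 less_le_trans le_less_trans)
    note m = convex_absorbing.minkowski_less[OF convex_absorbing_cyl this]
    obtain y where y: "y \<in> K" "\<forall>i<n. x i / (1 + inverse (real (Suc n))) = y i" using m(2) by (auto simp: cyl_def)
    have "x i = (1 + inverse (real (Suc n))) * y i" if "i < n" for i
      using y(2) that m(1) by (metis nonzero_mult_div_cancel_left times_divide_eq_right less_irrefl)
    then show ?thesis using y(1) by blast
  qed
  then obtain y where y: "\<And>n. y n \<in> K" "\<And>n i. i < n \<Longrightarrow> x i = (1 + inverse (real (Suc n))) * y n i" by metis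
  have "(\<lambda>n. y n i) \<longlonglongrightarrow> x i" for i
  proof -
    have "(\<lambda>n. x i / (1 + inverse (real (Suc n)))) \<longlonglongrightarrow> x i / (1 + 0)"
      by (intro tendsto_intros LIMSEQ_inverse_real_of_nat) auto
    moreover have "\<forall>\<^sub>F n in sequentially. x i / (1 + inverse (real (Suc n))) = y n i"
    proof (rule eventually_mono[OF eventually_gt_at_top[of i]])
      fix n assume "i < n"
      moreover have "1 + inverse (real (Suc n)) > 0" by (simp add: add_pos_pos)
      ultimately show "x i / (1 + inverse (real (Suc n))) = y n i"
        using y(2)[of i n] by (metis nonzero_mult_div_cancel_left less_irrefl)
    qed
    ultimately show ?thesis by (simp add: tendsto_cong)
  qed
  then have "y \<longlonglongrightarrow> x"
    by (rule tendsto_coordinatewise)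
  then show ?thesis using closed y(1) closed_sequentially by blast
qed

text \<open>
  The number \<open>d\<close> is a modulus of injectivity of \<open>G\<close>: later stages move the first \<open>n\<close> coordinates by at most
  \<open>d / 2\<close> in total, so that the limit still separates points.
\<close>

definition stage :: "nat \<Rightarrow> ((nat \<Rightarrow> real) \<Rightarrow> (nat \<Rightarrow> real)) \<times> real \<Rightarrow> bool" where
  "stage n = (\<lambda>(G, d). bij_betw G (partial_cube 0) (partial_cube n) \<and> continuous_on (partial_cube 0) G \<and> (\<forall>y\<in>partial_cube 0. \<forall>i\<ge>n. G y i = y i) \<and>
     (\<forall>\<eta>>0. \<exists>e>0. \<forall>y\<in>partial_cube 0. \<forall>y'\<in>partial_cube 0. (\<forall>i<n. \<bar>G y i - G y' i\<bar> \<le> e) \<longrightarrow> (\<forall>i<n. \<bar>y i - y' i\<bar> \<le> \<eta>)) \<and>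
     0 < d \<and> (\<forall>y\<in>partial_cube 0. \<forall>y'\<in>partial_cube 0. (\<forall>i<n. \<bar>G y i - G y' i\<bar> \<le> d) \<longrightarrow> (\<forall>i<n. \<bar>y i - y' i\<bar> \<le> (1/2) ^ n)))"

lemma stage_0: "stage 0 (\<lambda>y. y, 1)"
  by (auto simp: stage_def bij_betw_def intro: exI[of _ 1])

text \<open>The new map is the inverse of \<open>\<Phi>\<close> after \<open>G\<close>; compactness
  makes this inverse continuous. As \<open>G\<close> is \<open>\<Phi>\<close> after the new map,
  closeness of new values implies closeness of old ones, also in coordinate n, where
  \<open>G\<close> is the identity. This carries the modulus of injectivity forward.\<close>

lemma stage_Suc:
  assumes "stage n (G, d)"
  shows "\<exists>G' d'. stage (Suc n) (G', d') \<and> (\<forall>y\<in>partial_cube 0. \<forall>i<n. \<bar>G' y i - G y i\<bar> \<le> d / 4) \<and> d' \<le> d / 2"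
proof -
  from assms have G: "bij_betw G (partial_cube 0) (partial_cube n)" "continuous_on (partial_cube 0) G" "\<And>y i. y \<in> partial_cube 0 \<Longrightarrow> i \<ge> n \<Longrightarrow> G y i = y i"
    and uc: "\<And>\<eta>. \<eta> > 0 \<Longrightarrow> \<exists>e>0. \<forall>y\<in>partial_cube 0. \<forall>y'\<in>partial_cube 0. (\<forall>i<n. \<bar>G y i - G y' i\<bar> \<le> e) \<longrightarrow> (\<forall>i<n. \<bar>y i - y' i\<bar> \<le> \<eta>)"
    and d: "d > 0"
    by (auto simp: stage_def)
  obtain \<Phi> where \<Phi>: "bij_betw \<Phi> (partial_cube (Suc n)) (partial_cube n)" "continuous_on (partial_cube (Suc n)) \<Phi>"
     "\<And>z i. z \<in> partial_cube (Suc n) \<Longrightarrow> i < n \<Longrightarrow> \<bar>\<Phi> z i - z i\<bar> \<le> d / 4" "\<And>z i. i > n \<Longrightarrow> \<Phi> z i = z i"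
     "\<And>z w i. (\<And>j. j \<le> n \<Longrightarrow> z j = w j) \<Longrightarrow> i \<le> n \<Longrightarrow> \<Phi> z i = \<Phi> w i"
    using near_homeo[of "d / 4" n] d by fastforce
  obtain \<Psi> where \<Psi>: "homeomorphism (partial_cube (Suc n)) (partial_cube n) \<Phi> \<Psi>"
    using homeomorphism_compact[OF compact_partial_cube \<Phi>(2)] \<Phi>(1) by (auto simp: bij_betw_def)
  define G' where "G' = \<Psi> \<circ> G"
  have GZ: "G y \<in> partial_cube n" if "y \<in> partial_cube 0" for y using that G(1) by (auto simp: bij_betw_def)
  have G'partial_cube: "G' y \<in> partial_cube (Suc n)" and \<Phi>G': "\<Phi> (G' y) = G y" if "y \<in> partial_cube 0" for y
    using GZ[OF that] \<Psi> unfolding G'_def homeomorphism_def o_def by blast+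
  have b: "bij_betw G' (partial_cube 0) (partial_cube (Suc n))"
  proof -
    have "bij_betw \<Psi> (partial_cube n) (partial_cube (Suc n))"
      using \<Psi> unfolding homeomorphism_def by (intro bij_betw_byWitness[where f' = \<Phi>]) auto
    then show ?thesis unfolding G'_def using G(1) by (rule bij_betw_trans[rotated])
  qed
  have c: "continuous_on (partial_cube 0) G'"
    unfolding G'_def using G \<Psi> by (intro continuous_on_compose) (auto simp: homeomorphism_def bij_betw_def)
  have f: "G' y i = y i" if y: "y \<in> partial_cube 0" and i: "i \<ge> Suc n" for y i
    using \<Phi>(4)[of i "G' y"] \<Phi>G'[OF y] G(3)[OF y, of i] i by simp
  have close: "\<bar>G' y i - G y i\<bar> \<le> d / 4" if y: "y \<in> partial_cube 0" and i: "i < n" for y i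
    using \<Phi>(3)[OF G'partial_cube[OF y] i] \<Phi>G'[OF y] by (simp add: abs_minus_commute)
  have uc': "\<exists>e>0. \<forall>y\<in>partial_cube 0. \<forall>y'\<in>partial_cube 0. (\<forall>i<Suc n. \<bar>G' y i - G' y' i\<bar> \<le> e) \<longrightarrow> (\<forall>i<Suc n. \<bar>y i - y' i\<bar> \<le> \<eta>)"
    if \<eta>: "\<eta> > 0" for \<eta>
  proof -
    obtain e where e: "e > 0" "\<forall>y\<in>partial_cube 0. \<forall>y'\<in>partial_cube 0. (\<forall>i<n. \<bar>G y i - G y' i\<bar> \<le> e) \<longrightarrow> (\<forall>i<n. \<bar>y i - y' i\<bar> \<le> \<eta>)"
      using uc[OF \<eta>] by blast
    have "\<exists>e'>0. \<forall>z\<in>partial_cube (Suc n). \<forall>w\<in>partial_cube (Suc n). (\<forall>i<Suc n. \<bar>z i - w i\<bar> \<le> e') \<longrightarrow> (\<forall>i<Suc n. \<bar>\<Phi> z i - \<Phi> w i\<bar> \<le> min e \<eta>)"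
    proof (rule prefix_uniformly_continuous[OF compact_partial_cube \<Phi>(2)])
      show "(\<lambda>i. if i < Suc n then z i else 0) \<in> partial_cube (Suc n)" if "z \<in> partial_cube (Suc n)" for z
        using that by (intro truncate_partial_cube) (simp add: partial_cube_def)
      show "\<Phi> z i = \<Phi> w i" if "\<And>j. j < Suc n \<Longrightarrow> z j = w j" "i < Suc n" for z w i
        using that by (intro \<Phi>(5)) auto
      show "0 < min e \<eta>" using e \<eta> by simp
    qed
    then obtain e' where e': "e' > 0" and e'2: "\<And>z w i. z \<in> partial_cube (Suc n) \<Longrightarrow> w \<in> partial_cube (Suc n) \<Longrightarrow>
       (\<forall>i<Suc n. \<bar>z i - w i\<bar> \<le> e') \<Longrightarrow> i < Suc n \<Longrightarrow> \<bar>\<Phi> z i - \<Phi> w i\<bar> \<le> min e \<eta>"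
      by blast
    have "\<bar>y i - y' i\<bar> \<le> \<eta>"
      if y: "y \<in> partial_cube 0" "y' \<in> partial_cube 0" and cl: "\<forall>i<Suc n. \<bar>G' y i - G' y' i\<bar> \<le> e'" and i: "i < Suc n" for y y' i
    proof -
      have *: "\<bar>G y j - G y' j\<bar> \<le> min e \<eta>" if "j < Suc n" for j
        using e'2[OF G'partial_cube[OF y(1)] G'partial_cube[OF y(2)] cl that] \<Phi>G' y by simp
      show ?thesis
      proof (cases "i = n")
        case True
        then show ?thesis using *[of n] G(3)[OF y(1), of n] G(3)[OF y(2), of n] by simp
      next
        case False
        have "\<forall>i<n. \<bar>G y i - G y' i\<bar> \<le> e" using * by simp
        then show ?thesis using e(2) y i False by (metis less_SucE)
      qed
    qed
    then show ?thesis using e' by blast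
  qed
  obtain e where e: "e > 0" "\<forall>y\<in>partial_cube 0. \<forall>y'\<in>partial_cube 0. (\<forall>i<Suc n. \<bar>G' y i - G' y' i\<bar> \<le> e) \<longrightarrow> (\<forall>i<Suc n. \<bar>y i - y' i\<bar> \<le> (1/2) ^ Suc n)"
    using uc'[of "(1/2) ^ Suc n"] by auto
  \<comment> \<open>Passing to the minimum keeps a modulus for precision 2^-(n+1) and at least
    halves the previous one, so the later displacements are summable.\<close>
  have "stage (Suc n) (G', min e (d / 2))"
    unfolding stage_def prod.case using b c f uc' e d
    by (intro conjI ballI allI impI) (auto simp del: power_Suc)
  then show ?thesis using close by (intro exI[of _ G'] exI[of _ "min e (d / 2)"]) auto
qed

text \<open>The stages converge uniformly in each coordinate, so the limit is continuous.
  Compactness of the cube then makes bijectivity onto \<open>K\<close> sufficient for a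
  homeomorphism.\<close>

theorem cube_homeomorphic: "partial_cube 0 homeomorphic K"
proof -
  have "\<exists>f. \<forall>n. stage n (f n) \<and>
      ((\<forall>y\<in>partial_cube 0. \<forall>i<n. \<bar>fst (f (Suc n)) y i - fst (f n) y i\<bar> \<le> snd (f n) / 4) \<and> snd (f (Suc n)) \<le> snd (f n) / 2)"
  proof (rule dependent_nat_choice)
    show "\<exists>x. stage 0 x" using stage_0 by blast
    show "\<exists>y. stage (Suc n) y \<and> ((\<forall>z\<in>partial_cube 0. \<forall>i<n. \<bar>fst y z i - fst x z i\<bar> \<le> snd x / 4) \<and> snd y \<le> snd x / 2)"
      if "stage n x" for x n
      using stage_Suc[of n "fst x" "snd x"] that by auto
  qed
  then obtain f where f: "\<And>n. stage n (f n)"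
     "\<And>n y i. y \<in> partial_cube 0 \<Longrightarrow> i < n \<Longrightarrow> \<bar>fst (f (Suc n)) y i - fst (f n) y i\<bar> \<le> snd (f n) / 4"
     "\<And>n. snd (f (Suc n)) \<le> snd (f n) / 2"
    by blast
  define G d where "G = (\<lambda>n. fst (f n))" and "d = (\<lambda>n. snd (f n))"
  have st: "stage n (G n, d n)" for n using f(1)[of n] by (simp add: G_def d_def)
  have bij: "bij_betw (G n) (partial_cube 0) (partial_cube n)" and cont: "continuous_on (partial_cube 0) (G n)"
    and dpos: "0 < d n"
    and inj: "y \<in> partial_cube 0 \<Longrightarrow> y' \<in> partial_cube 0 \<Longrightarrow> \<forall>i<n. \<bar>G n y i - G n y' i\<bar> \<le> d n \<Longrightarrow> i < n \<Longrightarrow> \<bar>y i - y' i\<bar> \<le> (1/2) ^ n" for n y y' i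
    using st[of n] by (auto simp: stage_def)
  have step: "\<bar>G (Suc n) y i - G n y i\<bar> \<le> d n / 4" if "y \<in> partial_cube 0" "i < n" for n y i
    using f(2)[OF that] by (simp add: G_def d_def)
  have half: "d (Suc n) \<le> d n / 2" for n using f(3)[of n] by (simp add: d_def)
  \<comment> \<open>The bound is in telescoping form: halving gives d m / 4 at most (d m - d (m+1))
    / 2.\<close>
  have diff: "\<bar>G (n + k) y i - G n y i\<bar> \<le> (d n - d (n + k)) / 2" if "y \<in> partial_cube 0" "i < n" for n k y i
  proof (induction k)
    case (Suc k)
    have "\<bar>G (Suc (n + k)) y i - G (n + k) y i\<bar> \<le> d (n + k) / 4" using that by (intro step) auto
    moreover have "\<bar>G (Suc (n + k)) y i - G n y i\<bar> \<le>
      \<bar>G (Suc (n + k)) y i - G (n + k) y i\<bar> + \<bar>G (n + k) y i - G n y i\<bar>"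
      using abs_triangle_ineq[of "G (Suc (n + k)) y i - G (n + k) y i" "G (n + k) y i - G n y i"] by simp
    ultimately have "\<bar>G (Suc (n + k)) y i - G n y i\<bar> \<le> d (n + k) / 4 + (d n - d (n + k)) / 2"
      using Suc by linarith
    also have "\<dots> \<le> (d n - d (Suc (n + k))) / 2" using half[of "n + k"] by (simp add: field_simps)
    finally show ?case unfolding add_Suc_right .
  qed simp
  have dle: "d n \<le> d 0 * (1/2) ^ n" for n
  proof (induction n)
    case (Suc n) then show ?case using half[of n] by simp
  qed simp
  have d0: "d \<longlonglongrightarrow> 0"
  proof (rule tendsto_sandwich[OF _ _ tendsto_const])
    show "\<forall>\<^sub>F n in sequentially. 0 \<le> d n" using dpos by (simp add: less_imp_le)
    show "\<forall>\<^sub>F n in sequentially. d n \<le> d 0 * (1/2) ^ n" using dle by simp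
    have "(\<lambda>n. d 0 * (1/2) ^ n) \<longlonglongrightarrow> d 0 * 0" by (intro tendsto_intros) simp
    then show "(\<lambda>n. d 0 * (1/2) ^ n) \<longlonglongrightarrow> 0" by simp
  qed
  have diff': "\<bar>G m y i - G n y i\<bar> \<le> d n / 2" if "y \<in> partial_cube 0" "i < n" "n \<le> m" for m n y i
    using diff[OF that(1,2), of "m - n"] that(3) dpos[of m] by simp
  have conv: "convergent (\<lambda>n. G n y i)" if y: "y \<in> partial_cube 0" for y i
  proof (rule Cauchy_convergent, rule metric_CauchyI)
    fix e :: real assume "e > 0"
    then have "\<forall>\<^sub>F n in sequentially. d n < e \<and> i < n"
      using order_tendstoD(2)[OF d0] eventually_gt_at_top[of i] by (simp add: eventually_conj)
    then obtain N where N: "d N < e" "i < N" by (auto simp: eventually_sequentially)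
    have "dist (G m y i) (G n y i) < e" if "m \<ge> N" "n \<ge> N" for m n
      using diff'[OF y N(2) that(1)] diff'[OF y N(2) that(2)] N(1) unfolding dist_real_def by linarith
    then show "\<exists>M. \<forall>m\<ge>M. \<forall>n\<ge>M. dist (G m y i) (G n y i) < e" by blast
  qed
  define E where "E = (\<lambda>y i. lim (\<lambda>n. G n y i))"
  have lim: "(\<lambda>n. G n y i) \<longlonglongrightarrow> E y i" if "y \<in> partial_cube 0" for y i
    using conv[OF that, of i] by (simp add: E_def convergent_LIMSEQ_iff)
  have EG: "\<bar>E y i - G n y i\<bar> \<le> d n / 2" if y: "y \<in> partial_cube 0" and i: "i < n" for y i n
  proof (rule tendsto_upperbound)
    show "(\<lambda>m. \<bar>G m y i - G n y i\<bar>) \<longlonglongrightarrow> \<bar>E y i - G n y i\<bar>" by (intro tendsto_intros lim y)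
    show "\<forall>\<^sub>F m in sequentially. \<bar>G m y i - G n y i\<bar> \<le> d n / 2"
      using diff'[OF y i] by (auto simp: eventually_sequentially)
  qed simp
  have contE: "continuous_on (partial_cube 0) E"
  proof (rule continuous_on_coordinatewise_then_product)
    fix i
    show "continuous_on (partial_cube 0) (\<lambda>y. E y i)"
    proof (rule uniform_limit_theorem)
      show "\<forall>\<^sub>F n in sequentially. continuous_on (partial_cube 0) (\<lambda>y. G n y i)"
        using continuous_on_product_then_coordinatewise[OF cont] by simp
      show "uniform_limit (partial_cube 0) (\<lambda>n y. G n y i) (\<lambda>y. E y i) sequentially"
      proof (rule uniform_limitI)
        fix e :: real assume "e > 0"
        then have "\<forall>\<^sub>F n in sequentially. d n < e \<and> i < n"
          using order_tendstoD(2)[OF d0] eventually_gt_at_top[of i] by (simp add: eventually_conj)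
        then show "\<forall>\<^sub>F n in sequentially. \<forall>y\<in>partial_cube 0. dist (G n y i) (E y i) < e"
        proof (rule eventually_mono, intro ballI)
          fix n y assume "d n < e \<and> i < n" "y \<in> partial_cube 0"
          then show "dist (G n y i) (E y i) < e"
            using EG[of y i n] dpos[of n] unfolding dist_real_def by linarith
        qed
      qed
    qed simp
  qed
  have EK: "E y \<in> K" if y: "y \<in> partial_cube 0" for y
  proof (rule prefix_gauge_le_one_imp_mem)
    fix m
    have GE: "(\<lambda>n. G n y) \<longlonglongrightarrow> E y"
      by (rule tendsto_coordinatewise) (rule lim[OF y])
    have "(\<lambda>n. prefix_gauge m (G n y)) \<longlonglongrightarrow> prefix_gauge m (E y)"
      by (rule continuous_on_tendsto_compose[OF continuous_prefix_gauge GE]) auto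
    moreover have "prefix_gauge m (G n y) \<le> 1" if "n \<ge> m" for n
    proof -
      have "G n y \<in> partial_cube n" using bij[of n] y by (auto simp: bij_betw_def)
      then show ?thesis using prefix_gauge_mono[OF that, of "G n y"] by (simp add: partial_cube_def)
    qed
    then have "\<forall>\<^sub>F n in sequentially. prefix_gauge m (G n y) \<le> 1"
      using eventually_ge_at_top[of m] by (rule eventually_mono[rotated])
    ultimately show "prefix_gauge m (E y) \<le> 1"
      by (intro tendsto_upperbound[of "\<lambda>n. prefix_gauge m (G n y)"]) auto
  qed
  have injE: "inj_on E (partial_cube 0)"
  proof (rule inj_onI, rule ext)
    fix y y' i assume y: "y \<in> partial_cube 0" "y' \<in> partial_cube 0" and eq: "E y = E y'"
    have "\<bar>y i - y' i\<bar> \<le> (1/2) ^ n" if n: "i < n" for n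
    proof (rule inj[OF y _ n], intro allI impI)
      fix j assume "j < n"
      from EG[OF y(1) this] EG[OF y(2) this] show "\<bar>G n y j - G n y' j\<bar> \<le> d n"
        unfolding eq by linarith
    qed
    then have "\<forall>\<^sub>F n in sequentially. \<bar>y i - y' i\<bar> \<le> (1/2) ^ n"
      using eventually_gt_at_top[of i] by (rule eventually_mono[rotated])
    moreover have "(\<lambda>n. (1/2 :: real) ^ n) \<longlonglongrightarrow> 0" by (intro LIMSEQ_power_zero) simp
    ultimately have "\<bar>y i - y' i\<bar> \<le> 0"
      by (intro tendsto_lowerbound[of "\<lambda>n. (1/2 :: real) ^ n" 0]) auto
    then show "y i = y' i" by simp
  qed
  \<comment> \<open>Stage n hits \<open>x\<close> exactly on its first n coordinates, so the values
    of \<open>E\<close> at the chosen points converge to \<open>x\<close>; the image of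
    \<open>E\<close> is compact, hence closed.\<close>
  have "K \<subseteq> E ` partial_cube 0"
  proof
    fix x assume x: "x \<in> K"
    have "\<exists>y\<in>partial_cube 0. \<forall>i<n. G n y i = x i" for n
    proof -
      have "(\<lambda>i. if i < n then x i else 0) \<in> G n ` partial_cube 0"
        using truncate_partial_cube[OF prefix_gauge_le_one[OF x], of n] bij[of n] by (simp add: bij_betw_def)
      then obtain y where y: "y \<in> partial_cube 0" "(\<lambda>i. if i < n then x i else 0) = G n y" by blast
      have "G n y i = x i" if "i < n" for i using fun_cong[OF y(2), of i] that by simp
      then show ?thesis using y(1) by blast
    qed
    then obtain y where y: "\<And>n. y n \<in> partial_cube 0" "\<And>n i. i < n \<Longrightarrow> G n (y n) i = x i" by metis
    have "(\<lambda>n. E (y n) i) \<longlonglongrightarrow> x i" for i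
    proof (rule LIM_zero_cancel, rule Lim_null_comparison[OF _ d0])
      show "\<forall>\<^sub>F n in sequentially. norm (E (y n) i - x i) \<le> d n"
      proof (rule eventually_mono[OF eventually_gt_at_top[of i]])
        fix n assume "i < n"
        then show "norm (E (y n) i - x i) \<le> d n" using EG[OF y(1), of i n n] y(2)[of i n] dpos[of n] by simp
      qed
    qed
    then have "(\<lambda>n. E (y n)) \<longlonglongrightarrow> x"
      by (rule tendsto_coordinatewise)
    moreover have "closed (E ` partial_cube 0)"
      by (intro compact_imp_closed compact_continuous_image contE compact_partial_cube)
    ultimately show "x \<in> E ` partial_cube 0" using y(1) closed_sequentially[of "E ` partial_cube 0" "\<lambda>n. E (y n)" x] by blast
  qed
  then have "E ` partial_cube 0 = K" using EK by blast
  then show ?thesis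
    using homeomorphism_compact[OF compact_partial_cube contE _ injE] unfolding homeomorphic_def by blast
qed

end

section \<open>Amenable actions\<close>

lemma homeomorphic_imp_homeomorphic_space:
  assumes "S homeomorphic T"
  shows "top_of_set S homeomorphic_space top_of_set T"
proof -
  obtain f g where "homeomorphism S T f g" using assms by (auto simp: homeomorphic_def)
  then have "homeomorphic_maps (top_of_set S) (top_of_set T) f g"
    by (auto simp: homeomorphic_maps_def homeomorphism_def continuous_map_in_subtopology)
  then show ?thesis by (auto simp: homeomorphic_space_def)
qed

lemma hilbert_cube_eq: "hilbert_cube = top_of_set {f. \<forall>n. f n \<in> {0..1}}"
  by (simp add: hilbert_cube_def euclidean_product_topology)

lemma amenable_action_transfer:
  fixes G :: "('g, 'b) monoid_scheme" and X :: "'x topology"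
  assumes am: "amenable_action G X \<alpha>" and XY: "X homeomorphic_space Y" and G: "group G"
  shows "\<exists>\<beta>. amenable_action G Y \<beta>"
proof -
  obtain f g where fg: "homeomorphic_maps X Y f g" using XY by (auto simp: homeomorphic_space_def)
  then have f: "homeomorphic_map X Y f" and g: "homeomorphic_map Y X g"
    and gf: "\<And>x. x \<in> topspace X \<Longrightarrow> g (f x) = x" and fg: "\<And>y. y \<in> topspace Y \<Longrightarrow> f (g y) = y"
    by (auto simp: homeomorphic_maps_map)
  have gt: "g y \<in> topspace X" if "y \<in> topspace Y" for y
    using g that homeomorphic_imp_surjective_map by blast
  have act: "top_action G X \<alpha>" using am by (simp add: amenable_action_def)
  have ah: "homeomorphic_map X X (\<alpha> a)" if "a \<in> carrier G" for a using act that by (simp add: top_action_def)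
  have at: "\<alpha> a x \<in> topspace X" if "a \<in> carrier G" "x \<in> topspace X" for a x
    using homeomorphic_imp_surjective_map[OF ah[OF that(1)]] that(2) by blast
  define \<beta> where "\<beta> = (\<lambda>a. f \<circ> (\<alpha> a \<circ> g))"
  have "top_action G Y \<beta>"
    unfolding top_action_def
  proof (intro conjI ballI)
    show "homeomorphic_map Y Y (\<beta> a)" if "a \<in> carrier G" for a
      unfolding \<beta>_def by (rule homeomorphic_map_compose[OF homeomorphic_map_compose[OF g ah[OF that]] f])
    show "\<beta> \<one>\<^bsub>G\<^esub> y = y" if "y \<in> topspace Y" for y
      using act gt[OF that] fg[OF that] by (simp add: \<beta>_def top_action_def)
    show "\<beta> (a \<otimes>\<^bsub>G\<^esub> b) y = \<beta> a (\<beta> b y)" if "a \<in> carrier G" "b \<in> carrier G" "y \<in> topspace Y" for a b y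
      using act gt[OF that(3)] that gf at by (simp add: \<beta>_def top_action_def)
  qed
  moreover obtain bn :: "nat \<Rightarrow> 'x \<Rightarrow> 'g \<Rightarrow> real" where
    bn: "\<forall>n. \<forall>x\<in>topspace X. prob_vec G (bn n x)"
      "\<forall>n. \<forall>h\<in>carrier G. continuous_map X euclideanreal (\<lambda>x. bn n x h)"
      "\<forall>g\<in>carrier G. \<forall>\<epsilon>>0. \<exists>N. \<forall>n\<ge>N. \<forall>x\<in>topspace X. l1dist G (translate G g (bn n x)) (bn n (\<alpha> g x)) \<le> \<epsilon>"
    using am unfolding amenable_action_def by blast
  have "\<forall>n. \<forall>h\<in>carrier G. continuous_map Y euclideanreal (\<lambda>y. bn n (g y) h)"
    using bn(2) continuous_map_compose[OF homeomorphic_imp_continuous_map[OF g]] by (auto simp: o_def)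
  moreover have "\<forall>a\<in>carrier G. \<forall>\<epsilon>>0. \<exists>N. \<forall>n\<ge>N. \<forall>y\<in>topspace Y.
      l1dist G (translate G a (bn n (g y))) (bn n (g (\<beta> a y))) \<le> \<epsilon>"
    using bn(3) gt gf at by (simp add: \<beta>_def) meson
  ultimately have "amenable_action G Y \<beta>"
    unfolding amenable_action_def using bn(1) gt by (intro conjI exI[of _ "\<lambda>n y. bn n (g y)"]) auto
  then show ?thesis by blast
qed

lemma compact_Hausdorff_hilbert_cube:
  "compact_space hilbert_cube" "Hausdorff_space hilbert_cube" "topspace hilbert_cube \<noteq> {}"
proof -
  have "closed {f :: nat \<Rightarrow> real. \<forall>n. f n \<in> {0..1}}"
    by (auto simp: continuous_on_coordinate intro!: closed_Collect_all closed_Collect_conj closed_Collect_le)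
  then have "compact {f :: nat \<Rightarrow> real. \<forall>n. f n \<in> {0..1}}"
    by (rule compact_coordinatewise_bounded[where B = "\<lambda>_. 1"]) (simp add: abs_le_iff order_trans[of _ 0])
  then show "compact_space hilbert_cube" by (simp add: hilbert_cube_eq compact_space_subtopology)
  show "Hausdorff_space hilbert_cube" by (simp add: hilbert_cube_eq Hausdorff_space_subtopology)
  have "(\<lambda>_. 0) \<in> topspace hilbert_cube" by (simp add: hilbert_cube_eq)
  then show "topspace hilbert_cube \<noteq> {}" by blast
qed

lemma (in keller_body) hilbert_cube_homeomorphic: "top_of_set K homeomorphic_space hilbert_cube"
proof -
  have "homeomorphism (partial_cube 0) {f :: nat \<Rightarrow> real. \<forall>n. f n \<in> {0..1}} (\<lambda>z i. (z i + 1) / 2) (\<lambda>f i. 2 * f i - 1)"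
    proof (rule homeomorphismI)
    show "continuous_on (partial_cube 0) (\<lambda>z i. (z i + 1) / 2)"
      by (intro continuous_on_coordinatewise_then_product continuous_intros continuous_on_coordinate) auto
    show "continuous_on {f :: nat \<Rightarrow> real. \<forall>n. f n \<in> {0..1}} (\<lambda>f i. 2 * f i - 1)"
      by (intro continuous_on_coordinatewise_then_product continuous_intros continuous_on_coordinate)
    show "(\<lambda>z i. (z i + 1) / 2) ` partial_cube 0 \<subseteq> {f :: nat \<Rightarrow> real. \<forall>n. f n \<in> {0..1}}"
    proof (intro image_subsetI CollectI allI)
      fix z n assume "z \<in> partial_cube 0"
      then have "\<bar>z n\<bar> \<le> 1" by (simp add: partial_cube_0)
      then show "(z n + 1) / 2 \<in> {0..1}" by (simp add: abs_le_iff)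
    qed
    show "(\<lambda>f i. 2 * f i - 1) ` {f :: nat \<Rightarrow> real. \<forall>n. f n \<in> {0..1}} \<subseteq> partial_cube 0"
      by (auto simp: partial_cube_0 abs_le_iff)
    show "(\<lambda>i. 2 * ((z i + 1) / 2) - 1) = z" for z :: "nat \<Rightarrow> real"
      by (rule ext) (simp add: field_simps)
    show "(\<lambda>i. (2 * f i - 1 + 1) / 2) = f" for f :: "nat \<Rightarrow> real"
      by simp
  qed
  then have "partial_cube 0 homeomorphic {f :: nat \<Rightarrow> real. \<forall>n. f n \<in> {0..1}}" by (auto simp: homeomorphic_def)
  then have "K homeomorphic {f :: nat \<Rightarrow> real. \<forall>n. f n \<in> {0..1}}"
    using cube_homeomorphic homeomorphic_sym homeomorphic_trans by blast
  then show ?thesis unfolding hilbert_cube_eq by (rule homeomorphic_imp_homeomorphic_space)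
qed

section \<open>Finitely supported kernels from an amenable action\<close>

lemma uniform_finite_tail:
  assumes X: "compact_space X"
    and pv: "\<And>x. x \<in> topspace X \<Longrightarrow> prob_vec G (b x)"
    and cont: "\<And>h. h \<in> carrier G \<Longrightarrow> continuous_map X euclideanreal (\<lambda>x. b x h)"
    and \<eta>: "0 < \<eta>"
  shows "\<exists>F. finite F \<and> F \<subseteq> carrier G \<and> (\<forall>x\<in>topspace X. 1 - \<eta> \<le> sum (b x) F)"
proof -
  \<comment> \<open>The open sets on which \<open>F\<close> captures enough mass cover
    \<open>X\<close> by pointwise summability. They grow with \<open>F\<close> because entries are
    nonnegative, so the union of the sets in a finite subcover works at every point.\<close>
  define W where "W = (\<lambda>F. {x \<in> topspace X. sum (b x) F \<in> {1 - \<eta><..}})"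
  define S where "S = {F. finite F \<and> F \<subseteq> carrier G}"
  have op: "openin X (W F)" if "F \<in> S" for F
    unfolding W_def
    by (rule openin_continuous_map_preimage[where Y = euclideanreal])
       (use that in \<open>auto simp: S_def intro!: continuous_map_sum cont\<close>)
  have cov: "topspace X \<subseteq> \<Union> (W ` S)"
  proof
    fix x assume x: "x \<in> topspace X"
    have "(b x has_sum 1) (carrier G)" using pv[OF x] by (simp add: prob_vec_def)
    from has_sum_finite_approximation[OF this, of "\<eta> / 2"] \<eta>
    obtain F where F: "finite F" "F \<subseteq> carrier G" "dist (sum (b x) F) 1 \<le> \<eta> / 2" by auto
    then have "1 - \<eta> < sum (b x) F" using \<eta> unfolding dist_real_def by linarith
    then have "x \<in> W F" using x by (simp add: W_def)
    then show "x \<in> \<Union> (W ` S)" using F by (auto simp: S_def)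
  qed
  obtain \<F> where \<F>: "finite \<F>" "\<F> \<subseteq> W ` S" "topspace X \<subseteq> \<Union> \<F>"
    using X[unfolded compact_space_alt, rule_format, of "W ` S"] op cov by auto
  obtain C where C: "C \<subseteq> S" "finite C" "\<F> = W ` C"
    using finite_subset_image[OF \<F>(1,2)] by auto
  have fin: "finite (\<Union> C)" "\<Union> C \<subseteq> carrier G" using C by (auto simp: S_def)
  have "1 - \<eta> \<le> sum (b x) (\<Union> C)" if x: "x \<in> topspace X" for x
  proof -
    obtain F where F: "F \<in> C" "x \<in> W F" using \<F>(3) C(3) x by auto
    have "sum (b x) F \<le> sum (b x) (\<Union> C)"
      using F fin pv[OF x] by (intro sum_mono2) (auto simp: prob_vec_def)
    then show ?thesis using F(2) by (auto simp: W_def)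
  qed
  then show ?thesis using fin by blast
qed

lemma prob_vec_sum_le:
  assumes "prob_vec G b" "finite A" "A \<subseteq> carrier G" shows "sum b A \<le> 1"
  using assms by (intro finite_sum_le_has_sum[where A = "carrier G"]) (auto simp: prob_vec_def)

lemma prob_vec_tail_le:
  assumes b: "prob_vec G b" and F: "finite F" "F \<subseteq> carrier G" "1 - \<eta> \<le> sum b F"
    and A: "finite A" "A \<subseteq> carrier G" "A \<inter> F = {}"
  shows "sum b A \<le> \<eta>"
  using prob_vec_sum_le[OF b, of "A \<union> F"] F A by (simp add: sum.union_disjoint)

text \<open>A divergent infinite sum defaults to 0, so the comparison requires summability of the
  differences. It follows from domination by the sum of the two probability vectors, since left
  translation permutes the group.\<close>

lemma l1dist_finite_le:
  assumes "group G" and b: "prob_vec G b" and c: "prob_vec G c" and s: "s \<in> carrier G"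
    and T: "finite T" "T \<subseteq> carrier G"
  shows "(\<Sum>h\<in>T. \<bar>b (inv\<^bsub>G\<^esub> s \<otimes>\<^bsub>G\<^esub> h) - c h\<bar>) \<le> l1dist G (translate G s b) c"
proof -
  interpret group G by fact
  have "bij_betw (\<lambda>h. inv\<^bsub>G\<^esub> s \<otimes>\<^bsub>G\<^esub> h) (carrier G) (carrier G)"
    by (rule bij_betw_byWitness[where f' = "\<lambda>h. s \<otimes>\<^bsub>G\<^esub> h"]) (use s in \<open>auto simp: m_assoc[symmetric]\<close>)
  then have "(\<lambda>h. b (inv\<^bsub>G\<^esub> s \<otimes>\<^bsub>G\<^esub> h)) summable_on carrier G"
    using b has_sum_imp_summable unfolding prob_vec_def
    by (subst summable_on_reindex_bij_betw[of "\<lambda>h. inv\<^bsub>G\<^esub> s \<otimes>\<^bsub>G\<^esub> h"]) auto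
  moreover have "c summable_on carrier G" using c has_sum_imp_summable by (auto simp: prob_vec_def)
  ultimately have "(\<lambda>h. b (inv\<^bsub>G\<^esub> s \<otimes>\<^bsub>G\<^esub> h) + c h) summable_on carrier G" by (rule summable_on_add)
  then have "(\<lambda>h. \<bar>b (inv\<^bsub>G\<^esub> s \<otimes>\<^bsub>G\<^esub> h) - c h\<bar>) summable_on carrier G"
    by (rule summable_on_comparison_test) (use b c s in \<open>auto simp: prob_vec_def abs_le_iff add_increasing add_increasing2\<close>)
  then show ?thesis
    unfolding l1dist_def translate_def using T by (intro finite_sum_le_infsum) auto
qed

text \<open>
  The vector \<open>k n g\<close> plays the role of \<open>2 b\<^sup>n\<close> at the point \<open>g\<^sup>-\<^sup>1 x\<^sub>0\<close>, truncated to the finite set \<open>F n\<close>;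
  the factor 2 leaves room for the perturbations that make the convex set below infinite-dimensional.
\<close>

locale property_A = group G for G (structure) +
  fixes F :: "nat \<Rightarrow> 'a set" and k :: "nat \<Rightarrow> 'a \<Rightarrow> 'a \<Rightarrow> real" and e :: "nat \<Rightarrow> 'a \<Rightarrow> real"
  assumes finite_F: "finite (F n)" and F_subset: "F n \<subseteq> carrier G"
    and k_mass: "g \<in> carrier G \<Longrightarrow> 3/2 \<le> (\<Sum>h\<in>F n. k n g h)"
    and k_norm: "g \<in> carrier G \<Longrightarrow> (\<Sum>h\<in>F n. \<bar>k n g h\<bar>) \<le> 2"
    and k_support: "h \<notin> F n \<Longrightarrow> k n g h = 0"
    and k_diff: "g \<in> carrier G \<Longrightarrow> s \<in> carrier G \<Longrightarrow>
       (\<Sum>h\<in>F n \<union> (\<lambda>h. s \<otimes> h) ` F n. \<bar>k n g (inv s \<otimes> h) - k n (g \<otimes> inv s) h\<bar>) \<le> e n s"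
    and e_tendsto: "s \<in> carrier G \<Longrightarrow> (\<lambda>n. e n s) \<longlonglongrightarrow> 0"

lemma amenable_action_imp_property_A:
  fixes G :: "('g, 'b) monoid_scheme" and X :: "'x topology"
  assumes G: "group G" and am: "amenable_action G X \<alpha>" and X: "compact_space X" "topspace X \<noteq> {}"
  shows "\<exists>F k e. property_A G F k e"
proof -
  interpret group G by fact
  obtain bn :: "nat \<Rightarrow> 'x \<Rightarrow> 'g \<Rightarrow> real" where
    pv: "\<And>n x. x \<in> topspace X \<Longrightarrow> prob_vec G (bn n x)"
    and cont: "\<And>n h. h \<in> carrier G \<Longrightarrow> continuous_map X euclideanreal (\<lambda>x. bn n x h)"
    and lim: "\<And>g \<epsilon>. g \<in> carrier G \<Longrightarrow> \<epsilon> > 0 \<Longrightarrow>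
      \<exists>N. \<forall>n\<ge>N. \<forall>x\<in>topspace X. l1dist G (translate G g (bn n x)) (bn n (\<alpha> g x)) \<le> \<epsilon>"
    using am unfolding amenable_action_def by blast
  have act: "top_action G X \<alpha>" using am by (simp add: amenable_action_def)
  obtain x0 where x0: "x0 \<in> topspace X" using X by blast
  \<comment> \<open>With the inverse, multiplying g on the right by the inverse of s amounts to
    applying s to the orbit point. Approximate equivariance thereby becomes the variation bound
    \<open>k_diff\<close>.\<close>
  define y where "y = (\<lambda>g. \<alpha> (inv\<^bsub>G\<^esub> g) x0)"
  have yX: "y g \<in> topspace X" if "g \<in> carrier G" for g
  proof -
    have "homeomorphic_map X X (\<alpha> (inv\<^bsub>G\<^esub> g))" using act that by (simp add: top_action_def)
    then show ?thesis using homeomorphic_imp_surjective_map x0 by (fastforce simp: y_def)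
  qed
  have y_mult: "y (g \<otimes>\<^bsub>G\<^esub> inv\<^bsub>G\<^esub> s) = \<alpha> s (y g)" if "g \<in> carrier G" "s \<in> carrier G" for g s
    using act that x0 by (simp add: y_def inv_mult_group top_action_def)
  \<comment> \<open>At most 1/4, so the doubled truncated vectors keep mass 2 (1 - 1/4) = 3/2;
    tending to 0, so that the truncation error disappears.\<close>
  define \<eta> where "\<eta> = (\<lambda>n::nat. 1 / (4 * (real n + 1)))"
  have \<eta>: "\<eta> n > 0" "\<eta> n \<le> 1/4" for n by (auto simp: \<eta>_def field_simps)
  have "\<exists>F. finite F \<and> F \<subseteq> carrier G \<and> (\<forall>x\<in>topspace X. 1 - \<eta> n \<le> sum (bn n x) F)" for n
    by (rule uniform_finite_tail[OF X(1) pv cont \<eta>(1)])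
  then obtain F where F: "\<And>n. finite (F n)" "\<And>n. F n \<subseteq> carrier G"
      "\<And>n x. x \<in> topspace X \<Longrightarrow> 1 - \<eta> n \<le> sum (bn n x) (F n)"
    by metis
  have nn: "0 \<le> bn n x h" if "x \<in> topspace X" "h \<in> carrier G" for n x h
    using pv[OF that(1), of n] that(2) by (simp add: prob_vec_def)
  define k where "k = (\<lambda>n g h. if h \<in> F n then 2 * bn n (y g) h else 0)"
  define T where "T = (\<lambda>n s. F n \<union> (\<lambda>h. s \<otimes>\<^bsub>G\<^esub> h) ` F n)"
  have T: "finite (T n s)" "T n s \<subseteq> carrier G" if "s \<in> carrier G" for n s
    using F(1)[of n] F(2)[of n] that by (auto simp: T_def)
  define D where "D = (\<lambda>n g s. \<Sum>h\<in>T n s. \<bar>k n g (inv\<^bsub>G\<^esub> s \<otimes>\<^bsub>G\<^esub> h) - k n (g \<otimes>\<^bsub>G\<^esub> inv\<^bsub>G\<^esub> s) h\<bar>)"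
  have inj: "inj_on (\<lambda>h. inv\<^bsub>G\<^esub> s \<otimes>\<^bsub>G\<^esub> h) A" if "s \<in> carrier G" "A \<subseteq> carrier G" for s A
    using that by (intro inj_onI) (metis Units_eq Units_l_cancel inv_closed subsetD)
  have k_le: "0 \<le> k n g h" "k n g h \<le> 2 * bn n (y g) h" if "g \<in> carrier G" "h \<in> carrier G" for n g h
    using nn[OF yX[OF that(1)] that(2)] by (auto simp: k_def)
  \<comment> \<open>A crude bound for every n: the equivariance estimate controls large n only, but
    the supremum defining \<open>e\<close> must be finite at all levels.\<close>
  have D_le4: "D n g s \<le> 4" if g: "g \<in> carrier G" and s: "s \<in> carrier G" for n g s
  proof -
    let ?g' = "g \<otimes>\<^bsub>G\<^esub> inv\<^bsub>G\<^esub> s"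
    have "D n g s \<le> (\<Sum>h\<in>T n s. 2 * bn n (y g) (inv\<^bsub>G\<^esub> s \<otimes>\<^bsub>G\<^esub> h) + 2 * bn n (y ?g') h)"
      unfolding D_def
    proof (rule sum_mono)
      fix h assume "h \<in> T n s"
      then have h: "h \<in> carrier G" using T[OF s] by blast
      show "\<bar>k n g (inv\<^bsub>G\<^esub> s \<otimes>\<^bsub>G\<^esub> h) - k n ?g' h\<bar> \<le> 2 * bn n (y g) (inv\<^bsub>G\<^esub> s \<otimes>\<^bsub>G\<^esub> h) + 2 * bn n (y ?g') h"
        using k_le[of g "inv\<^bsub>G\<^esub> s \<otimes>\<^bsub>G\<^esub> h" n] k_le[of ?g' h n] g s h by (intro abs_leI) auto
    qed
    also have "\<dots> = 2 * sum (bn n (y g)) ((\<lambda>h. inv\<^bsub>G\<^esub> s \<otimes>\<^bsub>G\<^esub> h) ` T n s) + 2 * sum (bn n (y ?g')) (T n s)"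
      by (simp add: sum.distrib sum_distrib_left sum.reindex[OF inj[OF s T(2)[OF s]]])
    also have "\<dots> \<le> 2 * 1 + 2 * 1"
      using g s T[OF s] by (intro add_mono mult_left_mono prob_vec_sum_le[OF pv] yX) auto
    finally show ?thesis by simp
  qed
  have D_le: "D n g s \<le> 2 * l1dist G (translate G s (bn n (y g))) (bn n (\<alpha> s (y g))) + 4 * \<eta> n"
    if g: "g \<in> carrier G" and s: "s \<in> carrier G" for n g s
  proof -
    let ?g' = "g \<otimes>\<^bsub>G\<^esub> inv\<^bsub>G\<^esub> s"
    define u where "u = (\<lambda>h. bn n (y g) (inv\<^bsub>G\<^esub> s \<otimes>\<^bsub>G\<^esub> h))"
    define v where "v = bn n (y ?g')"
    \<comment> \<open>On \<open>A\<close> the translated vector loses its entry by truncation, on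
      \<open>B\<close> the other vector does. Each set costs at most twice the tail mass \<eta>,
      hence the error term 4 \<eta>.\<close>
    define A where "A = {h \<in> T n s. inv\<^bsub>G\<^esub> s \<otimes>\<^bsub>G\<^esub> h \<notin> F n}"
    define B where "B = {h \<in> T n s. h \<notin> F n}"
    have g': "?g' \<in> carrier G" using g s by simp
    have "D n g s \<le> (\<Sum>h\<in>T n s. 2 * \<bar>u h - v h\<bar> + (if inv\<^bsub>G\<^esub> s \<otimes>\<^bsub>G\<^esub> h \<notin> F n then 2 * u h else 0) + (if h \<notin> F n then 2 * v h else 0))"
      unfolding D_def
    proof (rule sum_mono)
      fix h assume "h \<in> T n s"
      then have h: "h \<in> carrier G" using T[OF s] by blast
      have kg: "k n g (inv\<^bsub>G\<^esub> s \<otimes>\<^bsub>G\<^esub> h) = (if inv\<^bsub>G\<^esub> s \<otimes>\<^bsub>G\<^esub> h \<in> F n then 2 * u h else 0)"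
        by (simp add: k_def u_def)
      have kg': "k n ?g' h = (if h \<in> F n then 2 * v h else 0)" by (simp add: k_def v_def)
      have "0 \<le> u h" "0 \<le> v h" using nn[OF yX[OF g]] nn[OF yX[OF g']] s h by (auto simp: u_def v_def)
      then show "\<bar>k n g (inv\<^bsub>G\<^esub> s \<otimes>\<^bsub>G\<^esub> h) - k n ?g' h\<bar> \<le>
         2 * \<bar>u h - v h\<bar> + (if inv\<^bsub>G\<^esub> s \<otimes>\<^bsub>G\<^esub> h \<notin> F n then 2 * u h else 0) + (if h \<notin> F n then 2 * v h else 0)"
        unfolding kg kg' by (auto simp: abs_if)
    qed
    also have "\<dots> = 2 * (\<Sum>h\<in>T n s. \<bar>u h - v h\<bar>) + 2 * sum u A + 2 * sum v B"
    proof -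
      have "(if P then 2 * a else 0) = 2 * (if P then a else 0)" for P and a :: real by simp
      then show ?thesis
        using T(1)[OF s] by (simp add: sum.distrib sum_distrib_left[symmetric] A_def B_def sum.inter_filter)
    qed
    also have "sum u A = sum (bn n (y g)) ((\<lambda>h. inv\<^bsub>G\<^esub> s \<otimes>\<^bsub>G\<^esub> h) ` A)"
    proof -
      have "A \<subseteq> carrier G" using T(2)[OF s] by (auto simp: A_def)
      then show ?thesis by (simp add: sum.reindex[OF inj[OF s]] u_def)
    qed
    also have "\<dots> \<le> \<eta> n"
      using T[OF s, of n] s by (intro prob_vec_tail_le[OF pv[OF yX[OF g]] F(1,2) F(3)[OF yX[OF g]]]) (auto simp: A_def)
    also have "sum v B \<le> \<eta> n"
      unfolding v_def using T[OF s, of n]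
      by (intro prob_vec_tail_le[OF pv[OF yX[OF g']] F(1,2) F(3)[OF yX[OF g']]]) (auto simp: B_def)
    also have "(\<Sum>h\<in>T n s. \<bar>u h - v h\<bar>) \<le> l1dist G (translate G s (bn n (y g))) (bn n (\<alpha> s (y g)))"
      unfolding u_def v_def y_mult[OF g s]
      by (rule l1dist_finite_le[OF G pv[OF yX[OF g]] _ s T[OF s]]) (use pv[OF yX[OF g']] y_mult[OF g s] in simp)
    finally show ?thesis by simp
  qed
  define e where "e = (\<lambda>n s. SUP g\<in>carrier G. D n g s)"
  have bdd: "bdd_above ((\<lambda>g. D n g s) ` carrier G)" if "s \<in> carrier G" for n s
    using D_le4[OF _ that] by (intro bdd_aboveI[of _ 4]) auto
  have D_e: "D n g s \<le> e n s" if "g \<in> carrier G" "s \<in> carrier G" for n g s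
    unfolding e_def using that by (intro cSUP_upper bdd) auto
  have "(\<lambda>n. e n s) \<longlonglongrightarrow> 0" if s: "s \<in> carrier G" for s
  proof (rule LIMSEQ_I)
    fix r :: real assume r: "r > 0"
    obtain N1 where N1: "\<forall>n\<ge>N1. \<forall>x\<in>topspace X. l1dist G (translate G s (bn n x)) (bn n (\<alpha> s x)) \<le> r / 8"
      using lim[OF s, of "r / 8"] r by auto
    obtain N2 where N2: "1 / (real N2 + 1) < r / 4"
      using r reals_Archimedean[of "r / 4"] by (auto simp: inverse_eq_divide add.commute)
    have "norm (e n s - 0) < r" if n: "n \<ge> max N1 N2" for n
    proof -
      have "4 * \<eta> n = 1 / (real n + 1)" unfolding \<eta>_def by (simp add: divide_simps)
      also have "\<dots> \<le> 1 / (real N2 + 1)" using n by (intro divide_left_mono) auto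
      finally have \<eta>n: "4 * \<eta> n < r / 4" using N2 by simp
      have "e n s \<le> r / 2"
        unfolding e_def
      proof (rule cSUP_least)
        show "D n g s \<le> r / 2" if g: "g \<in> carrier G" for g
        proof -
          have "l1dist G (translate G s (bn n (y g))) (bn n (\<alpha> s (y g))) \<le> r / 8"
            using N1 n yX[OF g] by simp
          then show ?thesis using D_le[OF g s, of n] \<eta>n by linarith
        qed
      qed auto
      moreover have "0 \<le> D n \<one>\<^bsub>G\<^esub> s" unfolding D_def by (intro sum_nonneg) auto
      then have "0 \<le> e n s" using D_e[OF one_closed s, of n] by linarith
      ultimately show ?thesis using r by simp
    qed
    then show "\<exists>no. \<forall>n\<ge>no. norm (e n s - 0) < r" by blast
  qed
  moreover have "3/2 \<le> (\<Sum>h\<in>F n. k n g h)" if "g \<in> carrier G" for n g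
  proof -
    have "(\<Sum>h\<in>F n. k n g h) = 2 * sum (bn n (y g)) (F n)"
      unfolding sum_distrib_left by (rule sum.cong) (auto simp: k_def)
    then show ?thesis using F(3)[OF yX[OF that], of n] \<eta>(2)[of n] by linarith
  qed
  moreover have "(\<Sum>h\<in>F n. \<bar>k n g h\<bar>) \<le> 2" if g: "g \<in> carrier G" for n g
  proof -
    have "(\<Sum>h\<in>F n. \<bar>k n g h\<bar>) = 2 * sum (bn n (y g)) (F n)"
      unfolding sum_distrib_left
    proof (rule sum.cong)
      fix h assume h: "h \<in> F n"
      then have "0 \<le> bn n (y g) h" using nn[OF yX[OF g]] F(2) by blast
      then show "\<bar>k n g h\<bar> = 2 * bn n (y g) h" using h by (simp add: k_def)
    qed simp
    then show ?thesis using prob_vec_sum_le[OF pv[OF yX[OF g], of n] F(1)[of n] F(2)[of n]] by linarith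
  qed
  ultimately have "property_A G F k e"
    using F(1,2) D_e unfolding D_def T_def
    by unfold_locales (auto simp: k_def)
  then show ?thesis by blast
qed

text \<open>One copy of the difference comes from the numerators and one from the normalising sums;
  masses of at least 1 prevent the divisions from enlarging either.\<close>

lemma sum_abs_normalized_diff_le:
  fixes u v :: "'a \<Rightarrow> real"
  assumes "1 \<le> (\<Sum>h\<in>T. \<bar>u h\<bar>)" "1 \<le> (\<Sum>h\<in>T. \<bar>v h\<bar>)"
  shows "(\<Sum>h\<in>T. \<bar>\<bar>u h\<bar> / (\<Sum>h\<in>T. \<bar>u h\<bar>) - \<bar>v h\<bar> / (\<Sum>h\<in>T. \<bar>v h\<bar>)\<bar>) \<le> 2 * (\<Sum>h\<in>T. \<bar>u h - v h\<bar>)"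
proof -
  define S S' where "S = (\<Sum>h\<in>T. \<bar>u h\<bar>)" and "S' = (\<Sum>h\<in>T. \<bar>v h\<bar>)"
  have S: "1 \<le> S" "1 \<le> S'" using assms by (auto simp: S_def S'_def)
  have SS: "\<bar>S' - S\<bar> \<le> (\<Sum>h\<in>T. \<bar>u h - v h\<bar>)"
  proof -
    have "\<bar>S' - S\<bar> = \<bar>\<Sum>h\<in>T. \<bar>v h\<bar> - \<bar>u h\<bar>\<bar>" by (simp add: S_def S'_def sum_subtractf)
    also have "\<dots> \<le> (\<Sum>h\<in>T. \<bar>\<bar>v h\<bar> - \<bar>u h\<bar>\<bar>)" by (rule sum_abs)
    also have "\<dots> \<le> (\<Sum>h\<in>T. \<bar>u h - v h\<bar>)" by (intro sum_mono) linarith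
    finally show ?thesis .
  qed
  have "(\<Sum>h\<in>T. \<bar>\<bar>u h\<bar> / S - \<bar>v h\<bar> / S'\<bar>) \<le> (\<Sum>h\<in>T. \<bar>u h - v h\<bar> + \<bar>v h\<bar> * (\<bar>S' - S\<bar> / S'))"
  proof (rule sum_mono)
    fix h
    have a: "\<bar>(\<bar>u h\<bar> - \<bar>v h\<bar>) / S\<bar> \<le> \<bar>u h - v h\<bar>"
    proof -
      have "\<bar>\<bar>u h\<bar> - \<bar>v h\<bar>\<bar> \<le> \<bar>u h - v h\<bar> * S"
        using mult_left_mono[OF S(1) abs_ge_zero, of "u h - v h"] abs_triangle_ineq3[of "u h" "v h"] by linarith
      then show ?thesis using S by (simp add: pos_divide_le_eq)
    qed
    have b: "\<bar>\<bar>v h\<bar> * ((S' - S) / S') / S\<bar> \<le> \<bar>v h\<bar> * (\<bar>S' - S\<bar> / S')"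
    proof -
      have "0 \<le> \<bar>v h\<bar> * (\<bar>S' - S\<bar> / S')" using S by simp
      from mult_left_mono[OF S(1) this] show ?thesis using S by (simp add: abs_mult pos_divide_le_eq)
    qed
    have "\<bar>u h\<bar> / S - \<bar>v h\<bar> / S' = (\<bar>u h\<bar> - \<bar>v h\<bar>) / S + \<bar>v h\<bar> * ((S' - S) / S') / S"
      using S by (simp add: field_simps)
    then show "\<bar>\<bar>u h\<bar> / S - \<bar>v h\<bar> / S'\<bar> \<le> \<bar>u h - v h\<bar> + \<bar>v h\<bar> * (\<bar>S' - S\<bar> / S')"
      using order_trans[OF abs_triangle_ineq add_mono[OF a b]] by presburger
  qed
  also have "\<dots> = (\<Sum>h\<in>T. \<bar>u h - v h\<bar>) + S' * (\<bar>S' - S\<bar> / S')"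
    by (simp only: sum.distrib sum_distrib_right[symmetric] S'_def[symmetric])
  also have "\<dots> \<le> 2 * (\<Sum>h\<in>T. \<bar>u h - v h\<bar>)" using S SS by simp
  finally show ?thesis by (simp add: S_def S'_def)
qed

section \<open>The convex space of admissible families\<close>

context property_A
begin

text \<open>An enumeration of this index set turns families into points of the sequence space in
  which Keller bodies live.\<close>

definition slots :: "(nat \<times> 'a \<times> 'a) set" where
  "slots = {(n, g, h). g \<in> carrier G \<and> h \<in> F n}"

definition family :: "(nat \<Rightarrow> real) \<Rightarrow> nat \<Rightarrow> 'a \<Rightarrow> 'a \<Rightarrow> real" where
  "family x n g h = (if g \<in> carrier G \<and> h \<in> F n then x (to_nat_on slots (n, g, h)) else 0)"

definition block :: "nat \<Rightarrow> 'a \<Rightarrow> 'a set" where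
  "block n s = F n \<union> (\<lambda>h. s \<otimes> h) ` F n"

definition slack :: "nat \<Rightarrow> real" where
  "slack n = 1 / (real n + 1)"

text \<open>
  Convex constraints, invariant under translation of \<open>g\<close>, which force \<open>\<bar>\<kappa> n \<one>\<bar>\<close>, once normalised, to be an
  approximately equivariant probability vector; \<open>k\<close> satisfies all of them with room to spare.
\<close>

definition admissible :: "(nat \<Rightarrow> 'a \<Rightarrow> 'a \<Rightarrow> real) \<Rightarrow> bool" where
  "admissible \<kappa> \<longleftrightarrow> (\<forall>n g. g \<in> carrier G \<longrightarrow>
     1 \<le> (\<Sum>h\<in>F n. \<kappa> n g h) \<and> (\<Sum>h\<in>F n. \<bar>\<kappa> n g h\<bar>) \<le> 3 \<and>
     (\<forall>s. s \<in> carrier G \<longrightarrow>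
        (\<Sum>h\<in>block n s. \<bar>\<kappa> n g (inv s \<otimes> h) - \<kappa> n (g \<otimes> inv s) h\<bar>) \<le> e n s + slack n))"

definition body :: "(nat \<Rightarrow> real) set" where
  "body = {x. admissible (family x)}"

definition centre :: "nat \<Rightarrow> real" where
  "centre j = (case from_nat_into slots j of (n, g, h) \<Rightarrow> k n g h)"

text \<open>The action permutes coordinates by left translation of the index g. It preserves the
  variation constraints because these multiply g on the right.\<close>

definition shift :: "'a \<Rightarrow> (nat \<Rightarrow> real) \<Rightarrow> (nat \<Rightarrow> real)" where
  "shift a x = (\<lambda>j. case from_nat_into slots j of (n, g, h) \<Rightarrow> family x n (inv a \<otimes> g) h)"

lemma slack: "0 < slack n" "slack n \<le> 1"
  by (auto simp: slack_def)

lemma finite_block: "finite (block n s)"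
  using finite_F by (simp add: block_def)

lemma block_subset: "s \<in> carrier G \<Longrightarrow> block n s \<subseteq> carrier G"
  using F_subset by (auto simp: block_def)

lemma family_add: "family (\<lambda>i. x i + y i) n g h = family x n g h + family y n g h"
  by (simp add: family_def)

lemma continuous_family: "continuous_on S (\<lambda>x. family x n g h)"
  by (cases "g \<in> carrier G \<and> h \<in> F n") (auto simp: family_def continuous_on_coordinate)

text \<open>Each constraint is a lower bound on a linear functional or an upper bound on a
  seminorm.\<close>

lemma admissible_convex:
  assumes \<kappa>: "admissible \<kappa>" and \<mu>: "admissible \<mu>" and u: "0 \<le> u" "u \<le> 1"
  shows "admissible (\<lambda>n g h. (1 - u) * \<kappa> n g h + u * \<mu> n g h)"
proof -
  have comb: "(1 - u) * a + u * b \<le> c" if "a \<le> c" "b \<le> c" for a b c :: real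
  proof -
    have "(1 - u) * a + u * b \<le> (1 - u) * c + u * c"
      using that u by (intro add_mono mult_left_mono) auto
    then show ?thesis by (simp add: algebra_simps)
  qed
  have comb': "c \<le> (1 - u) * a + u * b" if "c \<le> a" "c \<le> b" for a b c :: real
  proof -
    have "(1 - u) * c + u * c \<le> (1 - u) * a + u * b"
      using that u by (intro add_mono mult_left_mono) auto
    then show ?thesis by (simp add: algebra_simps)
  qed
  have abs: "(\<Sum>h\<in>A. \<bar>(1 - u) * p h + u * q h\<bar>) \<le> (1 - u) * (\<Sum>h\<in>A. \<bar>p h\<bar>) + u * (\<Sum>h\<in>A. \<bar>q h\<bar>)"
    for A and p q :: "'a \<Rightarrow> real"
  proof -
    have "(\<Sum>h\<in>A. \<bar>(1 - u) * p h + u * q h\<bar>) \<le> (\<Sum>h\<in>A. (1 - u) * \<bar>p h\<bar> + u * \<bar>q h\<bar>)"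
      using u by (intro sum_mono order_trans[OF abs_triangle_ineq]) (simp add: abs_mult)
    then show ?thesis by (simp add: sum.distrib sum_distrib_left)
  qed
  show ?thesis
    unfolding admissible_def
  proof (intro allI impI conjI)
    fix n g assume g: "g \<in> carrier G"
    show "1 \<le> (\<Sum>h\<in>F n. (1 - u) * \<kappa> n g h + u * \<mu> n g h)"
      using \<kappa> \<mu> g by (simp add: sum.distrib sum_distrib_left[symmetric] admissible_def comb')
    show "(\<Sum>h\<in>F n. \<bar>(1 - u) * \<kappa> n g h + u * \<mu> n g h\<bar>) \<le> 3"
      using \<kappa> \<mu> g by (intro order_trans[OF abs] comb) (auto simp: admissible_def)
    fix s assume s: "s \<in> carrier G"
    have "(1 - u) * \<kappa> n g (inv s \<otimes> h) + u * \<mu> n g (inv s \<otimes> h) -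
        ((1 - u) * \<kappa> n (g \<otimes> inv s) h + u * \<mu> n (g \<otimes> inv s) h) =
        (1 - u) * (\<kappa> n g (inv s \<otimes> h) - \<kappa> n (g \<otimes> inv s) h) + u * (\<mu> n g (inv s \<otimes> h) - \<mu> n (g \<otimes> inv s) h)" for h
      by (simp add: algebra_simps)
    then show "(\<Sum>h\<in>block n s. \<bar>(1 - u) * \<kappa> n g (inv s \<otimes> h) + u * \<mu> n g (inv s \<otimes> h) -
        ((1 - u) * \<kappa> n (g \<otimes> inv s) h + u * \<mu> n (g \<otimes> inv s) h)\<bar>) \<le> e n s + slack n"
      using \<kappa> \<mu> g s by (simp only:) (intro order_trans[OF abs] comb, auto simp: admissible_def)
  qed
qed

text \<open>Only one entry deviates from \<open>k\<close>, by at most \<open>slack m / 2\<close>.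
  This costs at most 1/2 in mass and norm, where the room is 3/2 - 1 and 3 - 2. In a variation
  constraint the entry can occur once in each of the two terms, so the total change is at most
  \<open>slack m\<close>.\<close>

lemma admissible_perturbation:
  assumes g0: "g0 \<in> carrier G" and h0: "h0 \<in> carrier G"
    and near: "\<And>n g h. g \<in> carrier G \<Longrightarrow> \<bar>\<kappa> n g h - k n g h\<bar> \<le> (if n = m \<and> g = g0 \<and> h = h0 then slack m / 2 else 0)"
  shows "admissible \<kappa>"
  unfolding admissible_def
proof (intro allI impI conjI)
  fix n g assume g: "g \<in> carrier G"
  have single: "(\<Sum>h\<in>A. if P \<and> h = c then slack m / 2 else 0) \<le> slack m / 2"
    if "finite A" for A :: "'a set" and c P
    using that slack(1)[of m] by (cases P) (auto simp: sum.delta)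
  have total: "(\<Sum>h\<in>F n. \<bar>\<kappa> n g h - k n g h\<bar>) \<le> slack m / 2"
  proof -
    have "(\<Sum>h\<in>F n. \<bar>\<kappa> n g h - k n g h\<bar>) \<le> (\<Sum>h\<in>F n. if (n = m \<and> g = g0) \<and> h = h0 then slack m / 2 else 0)"
      by (intro sum_mono order_trans[OF near[OF g]]) auto
    also have "\<dots> \<le> slack m / 2" by (rule single[OF finite_F])
    finally show ?thesis .
  qed
  have "(\<Sum>h\<in>F n. k n g h) - (\<Sum>h\<in>F n. \<kappa> n g h) \<le> (\<Sum>h\<in>F n. \<bar>\<kappa> n g h - k n g h\<bar>)"
    unfolding sum_subtractf[symmetric] by (intro sum_mono) auto
  then show "1 \<le> (\<Sum>h\<in>F n. \<kappa> n g h)" using total k_mass[OF g, of n] slack(2)[of m] by linarith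
  have "(\<Sum>h\<in>F n. \<bar>\<kappa> n g h\<bar>) \<le> (\<Sum>h\<in>F n. \<bar>k n g h\<bar> + \<bar>\<kappa> n g h - k n g h\<bar>)"
    by (intro sum_mono) auto
  then show "(\<Sum>h\<in>F n. \<bar>\<kappa> n g h\<bar>) \<le> 3"
    unfolding sum.distrib using total k_norm[OF g, of n] slack(2)[of m] by linarith
  fix s assume s: "s \<in> carrier G"
  have gs: "g \<otimes> inv s \<in> carrier G" using g s by simp
  have 1: "(\<Sum>h\<in>block n s. \<bar>\<kappa> n g (inv s \<otimes> h) - k n g (inv s \<otimes> h)\<bar>) \<le> slack n / 2"
  proof -
    have "(\<Sum>h\<in>block n s. \<bar>\<kappa> n g (inv s \<otimes> h) - k n g (inv s \<otimes> h)\<bar>) \<le>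
       (\<Sum>h\<in>block n s. if (n = m \<and> g = g0) \<and> h = s \<otimes> h0 then slack m / 2 else 0)"
    proof (rule sum_mono)
      fix h assume "h \<in> block n s"
      then have "h \<in> carrier G" using block_subset[OF s] by blast
      then have "inv s \<otimes> h = h0 \<longleftrightarrow> h = s \<otimes> h0" using inv_solve_left[of h0 s h] h0 s by auto
      then show "\<bar>\<kappa> n g (inv s \<otimes> h) - k n g (inv s \<otimes> h)\<bar> \<le> (if (n = m \<and> g = g0) \<and> h = s \<otimes> h0 then slack m / 2 else 0)"
        using near[OF g, of n "inv s \<otimes> h"] by simp
    qed
    also have "\<dots> \<le> slack n / 2"
      using single[OF finite_block, of "n = m \<and> g = g0" "s \<otimes> h0" n s] slack(1)[of n] by (cases "n = m") auto
    finally show ?thesis .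
  qed
  have 2: "(\<Sum>h\<in>block n s. \<bar>\<kappa> n (g \<otimes> inv s) h - k n (g \<otimes> inv s) h\<bar>) \<le> slack n / 2"
  proof -
    have "(\<Sum>h\<in>block n s. \<bar>\<kappa> n (g \<otimes> inv s) h - k n (g \<otimes> inv s) h\<bar>) \<le>
       (\<Sum>h\<in>block n s. if (n = m \<and> g \<otimes> inv s = g0) \<and> h = h0 then slack m / 2 else 0)"
      by (intro sum_mono order_trans[OF near[OF gs]]) auto
    also have "\<dots> \<le> slack n / 2"
      using single[OF finite_block, of "n = m \<and> g \<otimes> inv s = g0" h0 n s] slack(1)[of n] by (cases "n = m") auto
    finally show ?thesis .
  qed
  have "(\<Sum>h\<in>block n s. \<bar>\<kappa> n g (inv s \<otimes> h) - \<kappa> n (g \<otimes> inv s) h\<bar>) \<le>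
      (\<Sum>h\<in>block n s. \<bar>k n g (inv s \<otimes> h) - k n (g \<otimes> inv s) h\<bar> + \<bar>\<kappa> n g (inv s \<otimes> h) - k n g (inv s \<otimes> h)\<bar> +
        \<bar>\<kappa> n (g \<otimes> inv s) h - k n (g \<otimes> inv s) h\<bar>)"
    by (intro sum_mono) linarith
  then show "(\<Sum>h\<in>block n s. \<bar>\<kappa> n g (inv s \<otimes> h) - \<kappa> n (g \<otimes> inv s) h\<bar>) \<le> e n s + slack n"
    unfolding sum.distrib using 1 2 k_diff[OF g s, of n, folded block_def] by linarith
qed

lemma admissible_shift:
  assumes \<kappa>: "admissible \<kappa>" and a: "a \<in> carrier G"
    and \<mu>: "\<And>n g h. g \<in> carrier G \<Longrightarrow> \<mu> n g h = \<kappa> n (inv a \<otimes> g) h"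
  shows "admissible \<mu>"
  unfolding admissible_def
proof (intro allI impI)
  fix n g assume g: "g \<in> carrier G"
  have ag: "inv a \<otimes> g \<in> carrier G" using a g by simp
  have "\<mu> n (g \<otimes> inv s) h = \<kappa> n (inv a \<otimes> g \<otimes> inv s) h" if "s \<in> carrier G" for s h
    using \<mu> g a that by (simp add: m_assoc)
  then show "1 \<le> (\<Sum>h\<in>F n. \<mu> n g h) \<and> (\<Sum>h\<in>F n. \<bar>\<mu> n g h\<bar>) \<le> 3 \<and>
     (\<forall>s. s \<in> carrier G \<longrightarrow>
        (\<Sum>h\<in>block n s. \<bar>\<mu> n g (inv s \<otimes> h) - \<mu> n (g \<otimes> inv s) h\<bar>) \<le> e n s + slack n)"
    using \<kappa>[unfolded admissible_def, rule_format, OF ag] g by (simp add: \<mu>)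
qed

lemma closed_admissible:
  assumes "\<And>n g h. continuous_on UNIV (\<lambda>x. \<kappa> x n g h)"
  shows "closed {x. admissible (\<kappa> x)}"
  unfolding admissible_def
  by (intro closed_Collect_all closed_Collect_imp closed_Collect_conj closed_Collect_le
      continuous_intros assms) auto

context
  assumes countable_carrier: "countable (carrier G)"
begin

text \<open>Positive mass makes every \<open>F n\<close> nonempty, so there are infinitely many
  slots even if the group is finite. The enumeration is then a bijection with the naturals, and
  every coordinate of a sequence is an entry of its family.\<close>

lemma slots: "countable slots" "infinite slots"
proof -
  have "slots \<subseteq> UNIV \<times> carrier G \<times> carrier G" using F_subset by (auto simp: slots_def)
  moreover have "countable (UNIV \<times> carrier G \<times> carrier G :: (nat \<times> 'a \<times> 'a) set)"
    by (intro countable_SIGMA countable_carrier countableI_type)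
  ultimately show "countable slots" by (rule countable_subset)
  have "F n \<noteq> {}" for n using k_mass[OF one_closed, of n] by auto
  then have "\<forall>n. \<exists>h. h \<in> F n" by blast
  then obtain h where "\<And>n. h n \<in> F n" by metis
  then have "range (\<lambda>n. (n, \<one>, h n)) \<subseteq> slots" by (auto simp: slots_def)
  moreover have "infinite (range (\<lambda>n. (n, \<one>, h n)))" by (intro range_inj_infinite injI) auto
  ultimately show "infinite slots" by (rule infinite_super)
qed

lemma slot_cases:
  obtains n g h where "from_nat_into slots j = (n, g, h)" "g \<in> carrier G" "h \<in> F n" "to_nat_on slots (n, g, h) = j"
proof -
  have "from_nat_into slots j \<in> slots" using slots(2) by (intro from_nat_into) auto
  moreover have "to_nat_on slots (from_nat_into slots j) = j" using slots by simp
  ultimately show ?thesis using that by (cases "from_nat_into slots j") (auto simp: slots_def)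
qed

lemma from_to_slot: "g \<in> carrier G \<Longrightarrow> h \<in> F n \<Longrightarrow> from_nat_into slots (to_nat_on slots (n, g, h)) = (n, g, h)"
  using slots(1) by (simp add: slots_def)

lemma family_centre: "g \<in> carrier G \<Longrightarrow> family centre n g h = k n g h"
  by (simp add: family_def centre_def from_to_slot k_support)

lemma family_shift: "a \<in> carrier G \<Longrightarrow> g \<in> carrier G \<Longrightarrow> family (shift a x) n g h = family x n (inv a \<otimes> g) h"
  by (simp add: family_def shift_def from_to_slot)

lemma shift_one: "shift \<one> x = x"
proof
  fix j show "shift \<one> x j = x j"
    by (rule slot_cases[of j]) (simp add: shift_def family_def)
qed

lemma shift_mult: "a \<in> carrier G \<Longrightarrow> b \<in> carrier G \<Longrightarrow> shift (a \<otimes> b) x = shift a (shift b x)"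
proof
  fix j assume ab: "a \<in> carrier G" "b \<in> carrier G"
  show "shift (a \<otimes> b) x j = shift a (shift b x) j"
  proof (rule slot_cases[of j])
    fix n g h assume j: "from_nat_into slots j = (n, g, h)" "g \<in> carrier G"
    have "shift a (shift b x) j = family (shift b x) n (inv a \<otimes> g) h" by (simp add: shift_def[of a] j)
    also have "\<dots> = family x n (inv (a \<otimes> b) \<otimes> g) h"
      using ab j by (simp add: family_shift inv_mult_group m_assoc)
    finally show ?thesis by (simp add: shift_def j)
  qed
qed

lemma continuous_shift: "continuous_on S (shift a)"
proof (rule continuous_on_coordinatewise_then_product)
  show "continuous_on S (\<lambda>x. shift a x j)" for j
    by (cases "from_nat_into slots j") (simp add: shift_def continuous_family)
qed

lemma shift_body: "a \<in> carrier G \<Longrightarrow> x \<in> body \<Longrightarrow> shift a x \<in> body"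
  unfolding body_def using admissible_shift[of "family x" a "family (shift a x)"] family_shift by auto

text \<open>Moving \<open>centre\<close> to the origin turns the single-entry perturbations of
  \<open>k\<close> into the coordinate segments that a Keller body must contain.\<close>

lemma keller_body_translate: "keller_body {x. (\<lambda>i. x i + centre i) \<in> body}"
proof
  show "closed {x. (\<lambda>i. x i + centre i) \<in> body}"
    unfolding body_def mem_Collect_eq
    by (intro closed_admissible) (simp add: family_add, intro continuous_intros continuous_family)
next
  fix x y and u :: real
  assume x: "x \<in> {x. (\<lambda>i. x i + centre i) \<in> body}" and y: "y \<in> {x. (\<lambda>i. x i + centre i) \<in> body}"
    and u: "0 \<le> u" "u \<le> 1"
  have "family (\<lambda>i. (1 - u) * x i + u * y i + centre i) =
    (\<lambda>n g h. (1 - u) * family (\<lambda>i. x i + centre i) n g h + u * family (\<lambda>i. y i + centre i) n g h)"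
    by (intro ext) (simp add: family_def algebra_simps)
  then show "(\<lambda>i. (1 - u) * x i + u * y i) \<in> {x. (\<lambda>i. x i + centre i) \<in> body}"
    using admissible_convex[OF _ _ u] x y by (simp add: body_def)
next
  fix j
  show "\<exists>M. \<forall>x\<in>{x. (\<lambda>i. x i + centre i) \<in> body}. \<bar>x j\<bar> \<le> M"
  proof (intro exI[of _ "3 + \<bar>centre j\<bar>"] ballI)
    fix x assume "x \<in> {x. (\<lambda>i. x i + centre i) \<in> body}"
    then have adm: "admissible (family (\<lambda>i. x i + centre i))" by (simp add: body_def)
    obtain n g h where j: "g \<in> carrier G" "h \<in> F n" "to_nat_on slots (n, g, h) = j" by (rule slot_cases)
    have "\<bar>family (\<lambda>i. x i + centre i) n g h\<bar> \<le> (\<Sum>h\<in>F n. \<bar>family (\<lambda>i. x i + centre i) n g h\<bar>)"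
      by (rule member_le_sum[OF j(2) _ finite_F]) simp
    also have "\<dots> \<le> 3" using adm j(1) by (simp add: admissible_def)
    finally have "\<bar>x j + centre j\<bar> \<le> 3" using j by (simp add: family_def)
    then show "\<bar>x j\<bar> \<le> 3 + \<bar>centre j\<bar>" by linarith
  qed
next
  fix j
  obtain m g0 h0 where j: "g0 \<in> carrier G" "h0 \<in> F m" "to_nat_on slots (m, g0, h0) = j" by (rule slot_cases)
  have inj: "to_nat_on slots (n, g, h) = j \<longleftrightarrow> n = m \<and> g = g0 \<and> h = h0" if "g \<in> carrier G" "h \<in> F n" for n g h
    using that j from_to_slot by (metis prod.inject)
  have "(\<lambda>i. (if i = j then r else 0) + centre i) \<in> body" if r: "\<bar>r\<bar> = slack m / 2" for r
    unfolding body_def mem_Collect_eq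
  proof (rule admissible_perturbation[of g0 h0 _ m])
    show "\<bar>family (\<lambda>i. (if i = j then r else 0) + centre i) n g h - k n g h\<bar> \<le>
       (if n = m \<and> g = g0 \<and> h = h0 then slack m / 2 else 0)" if g: "g \<in> carrier G" for n g h
      using g inj[OF g, of h n] r family_centre[OF g, of n h] slack(1)[of m]
      by (simp add: family_add) (auto simp: family_def)
  qed (use j F_subset in auto)
  from this[of "slack m / 2"] this[of "- (slack m / 2)"] slack(1)[of m]
  show "\<exists>e>0. (\<lambda>i. if i = j then e else 0) \<in> {x. (\<lambda>i. x i + centre i) \<in> body} \<and>
      (\<lambda>i. if i = j then - e else 0) \<in> {x. (\<lambda>i. x i + centre i) \<in> body}"
    by (intro exI[of _ "slack m / 2"]) simp
qed

lemma body_homeomorphic: "top_of_set body homeomorphic_space hilbert_cube"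
proof -
  let ?K = "{x. (\<lambda>i. x i + centre i) \<in> body}"
  have "homeomorphism body ?K (\<lambda>x i. x i - centre i) (\<lambda>x i. x i + centre i)"
    by (rule homeomorphismI)
       (auto intro!: continuous_on_coordinatewise_then_product continuous_intros continuous_on_coordinate)
  then have "top_of_set body homeomorphic_space top_of_set ?K"
    by (intro homeomorphic_imp_homeomorphic_space) (auto simp: homeomorphic_def)
  then show ?thesis
    using keller_body.hilbert_cube_homeomorphic[OF keller_body_translate] homeomorphic_space_trans by blast
qed

text \<open>At g = 1 the variation constraint compares the s-translate of the kernel of x at 1 with
  its kernel at the inverse of s, which is the kernel of \<open>shift s x\<close> at 1.
  Normalisation at most doubles the error, uniformly on the body.\<close>

lemma amenable_shift: "amenable_action G (top_of_set body) shift"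
proof -
  define S where "S = (\<lambda>n x. \<Sum>h\<in>F n. \<bar>family x n \<one> h\<bar>)"
  define bn where "bn = (\<lambda>n x h. \<bar>family x n \<one> h\<bar> / S n x)"
  have S: "1 \<le> S n x" if "x \<in> body" for n x
  proof -
    have "1 \<le> (\<Sum>h\<in>F n. family x n \<one> h)" using that by (simp add: body_def admissible_def)
    also have "\<dots> \<le> S n x" unfolding S_def by (intro sum_mono) auto
    finally show ?thesis .
  qed
  have off: "family x n g h = 0" if "h \<notin> F n" for x n g h using that by (simp add: family_def)
  have pv: "prob_vec G (bn n x)" if x: "x \<in> body" for n x
    unfolding prob_vec_def
  proof
    show "\<forall>h\<in>carrier G. 0 \<le> bn n x h" using S[OF x, of n] by (simp add: bn_def)
    have "sum (bn n x) (F n) = 1"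
      using S[OF x, of n] by (simp add: bn_def sum_divide_distrib[symmetric] S_def)
    then have "(bn n x has_sum 1) (F n)" using has_sum_finite[OF finite_F, of "bn n x" n] by simp
    then show "(bn n x has_sum 1) (carrier G)"
      using F_subset by (subst has_sum_cong_neutral[where T = "F n" and g = "bn n x"]) (auto simp: bn_def off)
  qed
  have cont: "continuous_map (top_of_set body) euclideanreal (\<lambda>x. bn n x h)" for n h
  proof -
    have "continuous_on body (\<lambda>x. bn n x h)"
      unfolding bn_def
    proof (intro continuous_intros continuous_family ballI)
      show "continuous_on body (S n)"
        unfolding S_def by (intro continuous_intros continuous_family)
      show "S n x \<noteq> 0" if "x \<in> body" for x using S[OF that, of n] by simp
    qed
    then show ?thesis by simp
  qed
  have l1: "l1dist G (translate G s (bn n x)) (bn n (shift s x)) \<le> 2 * (e n s + slack n)"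
    if s: "s \<in> carrier G" and x: "x \<in> body" for n s x
  proof -
    define u where "u = (\<lambda>h. family x n \<one> (inv s \<otimes> h))"
    define v where "v = (\<lambda>h. family x n (inv s) h)"
    \<comment> \<open>The block contains the whole translated support, so the normalising sum over
      \<open>F n\<close> can be taken over the block. Both vectors then share one finite index
      set.\<close>
    have Su: "S n x = (\<Sum>h\<in>block n s. \<bar>u h\<bar>)"
    proof -
      have inj: "inj_on (\<lambda>h. s \<otimes> h) (F n)" using F_subset[of n] s by (intro inj_onI) (metis Units_eq Units_l_cancel subsetD)
      have "(\<Sum>h\<in>block n s. \<bar>u h\<bar>) = (\<Sum>h\<in>(\<lambda>h. s \<otimes> h) ` F n. \<bar>u h\<bar>)"
      proof (rule sum.mono_neutral_right[OF finite_block])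
        show "\<forall>h\<in>block n s - (\<lambda>h. s \<otimes> h) ` F n. \<bar>u h\<bar> = 0"
        proof
          fix h assume h: "h \<in> block n s - (\<lambda>h. s \<otimes> h) ` F n"
          then have "h \<in> carrier G" using block_subset[OF s] by blast
          then have "h = s \<otimes> (inv s \<otimes> h)" using s by (simp add: m_assoc[symmetric])
          then have "inv s \<otimes> h \<notin> F n" using h by blast
          then show "\<bar>u h\<bar> = 0" by (simp add: u_def off)
        qed
      qed (auto simp: block_def)
      also have "\<dots> = (\<Sum>h\<in>F n. \<bar>u (s \<otimes> h)\<bar>)" by (simp add: sum.reindex[OF inj])
      also have "\<dots> = S n x"
        unfolding S_def
      proof (rule sum.cong)
        fix h assume "h \<in> F n"
        then have "h \<in> carrier G" using F_subset by blast
        then show "\<bar>u (s \<otimes> h)\<bar> = \<bar>family x n \<one> h\<bar>" using s by (simp add: u_def m_assoc[symmetric])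
      qed simp
      finally show ?thesis ..
    qed
    have shift_v: "family (shift s x) n \<one> h = v h" for h using s by (simp add: family_shift v_def)
    have Sv: "S n (shift s x) = (\<Sum>h\<in>block n s. \<bar>v h\<bar>)"
      unfolding S_def shift_v
      by (rule sum.mono_neutral_left[OF finite_block]) (auto simp: block_def v_def off)
    have "l1dist G (translate G s (bn n x)) (bn n (shift s x)) =
       infsum (\<lambda>h. \<bar>\<bar>u h\<bar> / S n x - \<bar>v h\<bar> / S n (shift s x)\<bar>) (carrier G)"
      by (simp add: l1dist_def translate_def bn_def u_def shift_v)
    also have "\<dots> = infsum (\<lambda>h. \<bar>\<bar>u h\<bar> / S n x - \<bar>v h\<bar> / S n (shift s x)\<bar>) (block n s)"
    proof (rule infsum_cong_neutral)
      fix h assume h: "h \<in> carrier G - block n s"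
      then have "h = s \<otimes> (inv s \<otimes> h)" using s by (simp add: m_assoc[symmetric])
      then have "inv s \<otimes> h \<notin> F n" using h unfolding block_def by blast
      moreover have "h \<notin> F n" using h by (simp add: block_def)
      ultimately show "\<bar>\<bar>u h\<bar> / S n x - \<bar>v h\<bar> / S n (shift s x)\<bar> = 0" by (simp add: u_def v_def off)
    qed (use block_subset[OF s] in auto)
    also have "\<dots> = (\<Sum>h\<in>block n s. \<bar>\<bar>u h\<bar> / S n x - \<bar>v h\<bar> / S n (shift s x)\<bar>)"
      by (rule infsum_finite[OF finite_block])
    also have "\<dots> \<le> 2 * (\<Sum>h\<in>block n s. \<bar>u h - v h\<bar>)"
      unfolding Su Sv
      by (rule sum_abs_normalized_diff_le)
         (use S[OF x, of n] S[OF shift_body[OF s x], of n] in \<open>simp_all add: Su Sv\<close>)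
    also have "(\<Sum>h\<in>block n s. \<bar>u h - v h\<bar>) \<le> e n s + slack n"
    proof -
      have "(\<Sum>h\<in>block n s. \<bar>family x n \<one> (inv s \<otimes> h) - family x n (\<one> \<otimes> inv s) h\<bar>) \<le> e n s + slack n"
        using x s one_closed unfolding body_def admissible_def mem_Collect_eq by blast
      then show ?thesis using s by (simp add: u_def v_def)
    qed
    finally show ?thesis by simp
  qed
  have "top_action G (top_of_set body) shift"
    unfolding top_action_def
  proof (intro conjI ballI)
    fix a assume a: "a \<in> carrier G"
    have "shift (inv a) (shift a x) = x" "shift a (shift (inv a) x) = x" for x
      using a shift_mult[of "inv a" a x] shift_mult[of a "inv a" x] by (simp_all add: shift_one)
    moreover have "continuous_map (top_of_set body) (top_of_set body) (shift b)" if "b \<in> carrier G" for b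
      using shift_body[OF that] continuous_shift by (auto simp: continuous_map_in_subtopology)
    ultimately have "homeomorphic_maps (top_of_set body) (top_of_set body) (shift a) (shift (inv a))"
      using a by (simp add: homeomorphic_maps_def)
    then show "homeomorphic_map (top_of_set body) (top_of_set body) (shift a)" by (simp add: homeomorphic_maps_map)
  qed (simp_all add: shift_one shift_mult)
  moreover have "\<exists>N. \<forall>n\<ge>N. \<forall>x\<in>topspace (top_of_set body). l1dist G (translate G s (bn n x)) (bn n (shift s x)) \<le> \<epsilon>"
    if s: "s \<in> carrier G" and \<epsilon>: "\<epsilon> > 0" for s \<epsilon>
  proof -
    have "slack \<longlonglongrightarrow> 0"
      using LIMSEQ_inverse_real_of_nat by (simp add: slack_def[abs_def] inverse_eq_divide add.commute)
    then have "(\<lambda>n. 2 * (e n s + slack n)) \<longlonglongrightarrow> 2 * (0 + 0)" by (intro tendsto_intros e_tendsto[OF s])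
    then have "\<forall>\<^sub>F n in sequentially. 2 * (e n s + slack n) < \<epsilon>" using order_tendstoD(2) \<epsilon> by fastforce
    then obtain N where "\<And>n. n \<ge> N \<Longrightarrow> 2 * (e n s + slack n) < \<epsilon>" by (auto simp: eventually_sequentially)
    then have "l1dist G (translate G s (bn n x)) (bn n (shift s x)) \<le> \<epsilon>" if "n \<ge> N" "x \<in> body" for n x
      using l1[OF s that(2), of n] that(1) by fastforce
    then show ?thesis by auto
  qed
  ultimately show ?thesis
    unfolding amenable_action_def using pv cont by (intro conjI exI[of _ bn]) auto
qed

end

end

text \<open>The compact space may live on any type, so the forward direction is stated for an
  arbitrary \<open>'x\<close>; in the converse the cube itself is the space, and its points have
  type \<open>nat \<Rightarrow> real\<close>.\<close>

theorem theorem3p3p6: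
  fixes G :: "('g, 'b) monoid_scheme"
  assumes "group G" and "countable (carrier G)"
  shows "(amenable_at_infinity_on TYPE('x) G \<longrightarrow> (\<exists>\<alpha>. amenable_action G hilbert_cube \<alpha>))
       \<and> ((\<exists>\<alpha>. amenable_action G hilbert_cube \<alpha>) \<longrightarrow> amenable_at_infinity_on TYPE(nat \<Rightarrow> real) G)"
proof (intro conjI impI)
  assume "amenable_at_infinity_on TYPE('x) G"
  then obtain X :: "'x topology" and \<alpha> where X: "topspace X \<noteq> {}" "compact_space X" "amenable_action G X \<alpha>"
    unfolding amenable_at_infinity_on_def by blast
  obtain F k e where "property_A G F k e"
    using amenable_action_imp_property_A[OF assms(1) X(3,2,1)] by blast
  then interpret property_A G F k e .
  show "\<exists>\<alpha>. amenable_action G hilbert_cube \<alpha>"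
    by (rule amenable_action_transfer[OF amenable_shift[OF assms(2)] body_homeomorphic[OF assms(2)] assms(1)])
next
  assume "\<exists>\<alpha>. amenable_action G hilbert_cube \<alpha>"
  then show "amenable_at_infinity_on TYPE(nat \<Rightarrow> real) G"
    unfolding amenable_at_infinity_on_def using compact_Hausdorff_hilbert_cube by blast
qed

end
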